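(* Let $E$ be a real (resp. complex) Banach space with $\dim E \ge 2$, and let $n \ge 2$ be an integer. Then the spaces $\hat{\otimes}_{n,s,\varepsilon}E$ and $\mathcal{P}({}^n E)$ are not real (resp. complex) strictly convex. That is: if $E$ is real, neither of the two spaces is strictly convex; if $E$ is complex, neither of the two spaces is complex strictly convex.
   Context: For a Banach space $X$ (real or complex), $B_X$ denotes its closed unit ball, $S_X$ its unit sphere, $X'$ its Banach dual, and $\langle \phi, x\rangle = \phi(x)$ for $\phi\in X'$, $x\in X$. A point $x\in S_X$ is a (real) extreme point of $B_X$ if, for every $y\in X$, $\|x\pm y\|\le 1$ implies $y=0$. The space $X$ is (real) strictly convex if every element of $S_X$ is an extreme point of $B_X$. If $X$ is complex, a point $x\in S_X$ is a complex extreme point of $B_X$ if, for every $y\in X$, $\sup\{\|x+\zeta y\| : \zeta\in\mathbb{C},\ |\zeta|=1\}\le 1$ implies $y=0$. The complex Banach space $X$ is complex strictly convex if every element of $S_X$ is a complex extreme point of $B_X$. For a Banach space $E$, $\otimes_{n,s}E$ is the space of all tensors of the form $u=\sum_{j=1}^k \lambda_j\, x_j\otimes x_j\otimes\cdots\otimes x_j$ ($n$ factors in each term), with $x_j\in E$ and scalars $\lambda_j$. Its injective norm is $$\|u\|_\varepsilon=\sup\left\{\left|\sum_{j=1}^k \lambda_j\langle\phi,x_j\rangle^n\right| : \phi\in B_{E'}\right\}.$$ The completion of $\otimes_{n,s}E$ with respect to this norm is denoted $\hat{\otimes}_{n,s,\varepsilon}E$ (the $n$-fold symmetric injective tensor product).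 $\mathcal{P}({}^nE)$ is the Banach space of all continuous scalar-valued $n$-homogeneous polynomials on $E$ with the norm $\|P\|=\sup_{x\in B_E}|P(x)|$. *)

theory Defs
  imports "HOL-Analysis.Analysis"
begin

text \<open>
  A Banach space \<open>E\<close> over the scalar field \<open>'k\<close> (real or complex) is a type of class
  \<^class>\<open>banach\<close> with a multiplication by scalars from \<open>'k\<close> that is compatible with the norm and
  extends the real scalar multiplication of the type.
\<close>

locale banach_over = vector_space sc
  for sc :: "'k::real_normed_field \<Rightarrow> 'a::banach \<Rightarrow> 'a" +
  assumes norm_scale: "norm (sc c x) = norm c * norm x"
    and scale_of_real: "sc (of_real r) x = r *\<^sub>R x"

lemma banach_over_scaleR: "banach_over (scaleR :: real \<Rightarrow> 'a::banach \<Rightarrow> 'a)"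
  by unfold_locales (auto simp: algebra_simps)

text \<open>
  The spaces built from \<open>E\<close> depend on the number \<open>n\<close> and are therefore not types; they are
  represented by a carrier set with explicit operations and norm.
\<close>

record ('k, 'v) nspace =
  pts :: "'v set"
  vadd :: "'v \<Rightarrow> 'v \<Rightarrow> 'v"
  vzero :: 'v
  smul :: "'k \<Rightarrow> 'v \<Rightarrow> 'v"
  nrm :: "'v \<Rightarrow> real"

definition vsub :: "('k::real_normed_field, 'v) nspace \<Rightarrow> 'v \<Rightarrow> 'v \<Rightarrow> 'v" where
  "vsub X x y = vadd X x (smul X (-1) y)"

subsection \<open>Strict convexity\<close>

definition unit_sphere :: "('k, 'v) nspace \<Rightarrow> 'v set" where
  "unit_sphere X = {x \<in> pts X. nrm X x = 1}"

definition extreme_pt :: "('k::real_normed_field, 'v) nspace \<Rightarrow> 'v \<Rightarrow> bool" where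
  "extreme_pt X x \<longleftrightarrow> x \<in> unit_sphere X \<and>
     (\<forall>y\<in>pts X. nrm X (vadd X x y) \<le> 1 \<and> nrm X (vsub X x y) \<le> 1 \<longrightarrow> y = vzero X)"

definition strictly_convex :: "('k::real_normed_field, 'v) nspace \<Rightarrow> bool" where
  "strictly_convex X \<longleftrightarrow> (\<forall>x\<in>unit_sphere X. extreme_pt X x)"

definition complex_extreme_pt :: "(complex, 'v) nspace \<Rightarrow> 'v \<Rightarrow> bool" where
  "complex_extreme_pt X x \<longleftrightarrow> x \<in> unit_sphere X \<and>
     (\<forall>y\<in>pts X. (SUP \<zeta>\<in>{\<zeta>. cmod \<zeta> = 1}. nrm X (vadd X x (smul X \<zeta> y))) \<le> 1 \<longrightarrow> y = vzero X)"

definition complex_strictly_convex :: "(complex, 'v) nspace \<Rightarrow> bool" where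
  "complex_strictly_convex X \<longleftrightarrow> (\<forall>x\<in>unit_sphere X. complex_extreme_pt X x)"

subsection \<open>Completion\<close>

text \<open>
  Cauchy sequences modulo null sequences; the operations are those on representatives.
\<close>

definition cauchy_seqs :: "('k::real_normed_field, 'v) nspace \<Rightarrow> (nat \<Rightarrow> 'v) set" where
  "cauchy_seqs X = {s. (\<forall>i. s i \<in> pts X) \<and>
     (\<forall>e>0. \<exists>N. \<forall>i\<ge>N. \<forall>j\<ge>N. nrm X (vsub X (s i) (s j)) < e)}"

definition null_rel :: "('k::real_normed_field, 'v) nspace \<Rightarrow> ((nat \<Rightarrow> 'v) \<times> (nat \<Rightarrow> 'v)) set" where
  "null_rel X = {(s, t). s \<in> cauchy_seqs X \<and> t \<in> cauchy_seqs X \<and>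
     (\<lambda>i. nrm X (vsub X (s i) (t i))) \<longlonglongrightarrow> 0}"

definition completion ::
  "('k::real_normed_field, 'v) nspace \<Rightarrow> ('k, (nat \<Rightarrow> 'v) set) nspace" where
  "completion X = \<lparr>
     pts = cauchy_seqs X // null_rel X,
     vadd = (\<lambda>S T. \<Union>s\<in>S. \<Union>t\<in>T. null_rel X `` {\<lambda>i. vadd X (s i) (t i)}),
     vzero = null_rel X `` {\<lambda>i. vzero X},
     smul = (\<lambda>c S. \<Union>s\<in>S. null_rel X `` {\<lambda>i. smul X c (s i)}),
     nrm = (\<lambda>S. THE L. \<forall>s\<in>S. (\<lambda>i. nrm X (s i)) \<longlonglongrightarrow> L) \<rparr>"

subsection \<open>Multilinear forms and homogeneous polynomials\<close>

text \<open>
  Points of \<open>E\<^sup>n\<close> are the restrictions to \<open>{..<n}\<close> of functions on the natural numbers; an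
  \<open>n\<close>-linear form ignores the values at the other indices.
\<close>

definition multilinear_form ::
  "('k::real_normed_field \<Rightarrow> 'a::banach \<Rightarrow> 'a) \<Rightarrow> nat \<Rightarrow> ((nat \<Rightarrow> 'a) \<Rightarrow> 'k) \<Rightarrow> bool" where
  "multilinear_form sc n A \<longleftrightarrow>
     (\<forall>i<n. \<forall>x. Vector_Spaces.linear sc (*) (\<lambda>v. A (x(i := v)))) \<and>
     (\<forall>x y. (\<forall>i<n. x i = y i) \<longrightarrow> A x = A y)"

definition homogeneous_polys ::
  "('k::real_normed_field \<Rightarrow> 'a::banach \<Rightarrow> 'a) \<Rightarrow> nat \<Rightarrow> ('a \<Rightarrow> 'k) set" where
  "homogeneous_polys sc n =
     {P. continuous_on UNIV P \<and> (\<exists>A. multilinear_form sc n A \<and> (\<forall>x. P x = A (\<lambda>_. x)))}"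

definition poly_space ::
  "('k::real_normed_field \<Rightarrow> 'a::banach \<Rightarrow> 'a) \<Rightarrow> nat \<Rightarrow> ('k, 'a \<Rightarrow> 'k) nspace" where
  "poly_space sc n = \<lparr>
     pts = homogeneous_polys sc n,
     vadd = (\<lambda>P Q x. P x + Q x),
     vzero = (\<lambda>x. 0),
     smul = (\<lambda>c P x. c * P x),
     nrm = (\<lambda>P. SUP x\<in>cball 0 1. norm (P x)) \<rparr>"

subsection \<open>Symmetric injective tensor products\<close>

definition dual_ball :: "('k::real_normed_field \<Rightarrow> 'a::banach \<Rightarrow> 'a) \<Rightarrow> ('a \<Rightarrow> 'k) set" where
  "dual_ball sc =
     {\<phi>. Vector_Spaces.linear sc (*) \<phi> \<and> bounded_linear \<phi> \<and> onorm \<phi> \<le> 1}"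

text \<open>
  As in Ryan's \<open>Introduction to Tensor Products of Banach Spaces\<close>, the elementary tensor
  \<open>x\<^sub>0 \<otimes> \<dots> \<otimes> x\<^sub>n\<^sub>-\<^sub>1\<close> is the evaluation functional \<open>A \<mapsto> A (x\<^sub>0, \<dots>, x\<^sub>n\<^sub>-\<^sub>1)\<close> on
  the space of all \<open>n\<close>-linear forms on \<open>E\<close>. The value \<open>0\<close> off this space makes equality of
  functions agree with equality of tensors.
\<close>

definition tensor ::
  "('k::real_normed_field \<Rightarrow> 'a::banach \<Rightarrow> 'a) \<Rightarrow> nat \<Rightarrow> (nat \<Rightarrow> 'a) \<Rightarrow> ((nat \<Rightarrow> 'a) \<Rightarrow> 'k) \<Rightarrow> 'k"
  where "tensor sc n x = (\<lambda>A. if multilinear_form sc n A then A x else 0)"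

definition sym_tensors ::
  "('k::real_normed_field \<Rightarrow> 'a::banach \<Rightarrow> 'a) \<Rightarrow> nat \<Rightarrow> (((nat \<Rightarrow> 'a) \<Rightarrow> 'k) \<Rightarrow> 'k) set" where
  "sym_tensors sc n =
     {u. \<exists>(k::nat) lam x. u = (\<lambda>A. \<Sum>j<k. lam j * tensor sc n (\<lambda>_. x j) A)}"

text \<open>
  A functional \<open>\<phi>\<close> acts on a tensor through the \<open>n\<close>-linear form
  \<open>(x\<^sub>0, \<dots>, x\<^sub>n\<^sub>-\<^sub>1) \<mapsto> \<phi> x\<^sub>0 \<cdots> \<phi> x\<^sub>n\<^sub>-\<^sub>1\<close>, so that the norm below does not refer to a
  representation of the tensor; \<open>inj_norm_sum\<close> gives its value for a given representation.
\<close>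

definition inj_norm ::
  "('k::real_normed_field \<Rightarrow> 'a::banach \<Rightarrow> 'a) \<Rightarrow> nat \<Rightarrow> (((nat \<Rightarrow> 'a) \<Rightarrow> 'k) \<Rightarrow> 'k) \<Rightarrow> real" where
  "inj_norm sc n u = (SUP \<phi>\<in>dual_ball sc. norm (u (\<lambda>x. \<Prod>i<n. \<phi> (x i))))"

definition sym_tensor_space ::
  "('k::real_normed_field \<Rightarrow> 'a::banach \<Rightarrow> 'a) \<Rightarrow> nat \<Rightarrow> ('k, ((nat \<Rightarrow> 'a) \<Rightarrow> 'k) \<Rightarrow> 'k) nspace" where
  "sym_tensor_space sc n = \<lparr>
     pts = sym_tensors sc n,
     vadd = (\<lambda>u v A. u A + v A),
     vzero = (\<lambda>A. 0),
     smul = (\<lambda>c u A. c * u A),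
     nrm = inj_norm sc n \<rparr>"

definition sym_inj_tensor_product ::
  "('k::real_normed_field \<Rightarrow> 'a::banach \<Rightarrow> 'a) \<Rightarrow> nat
    \<Rightarrow> ('k, (nat \<Rightarrow> ((nat \<Rightarrow> 'a) \<Rightarrow> 'k) \<Rightarrow> 'k) set) nspace" where
  "sym_inj_tensor_product sc n = completion (sym_tensor_space sc n)"

lemma multilinear_form_prod:
  assumes "Vector_Spaces.linear sc (*) \<phi>"
  shows "multilinear_form sc n (\<lambda>x. \<Prod>i<n. \<phi> (x i))"
proof -
  interpret l: Vector_Spaces.linear sc "(*)" \<phi> by fact
  have eq: "(\<Prod>j<n. \<phi> ((x(i := v)) j)) = \<phi> v * (\<Prod>j\<in>{..<n} - {i}. \<phi> (x j))"
    if "i < n" for i v and x :: "nat \<Rightarrow> 'b"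
  proof -
    have "(\<Prod>j<n. \<phi> ((x(i := v)) j)) = \<phi> v * (\<Prod>j\<in>{..<n} - {i}. \<phi> ((x(i := v)) j))"
      using that by (subst prod.remove[where x = i]) auto
    also have "(\<Prod>j\<in>{..<n} - {i}. \<phi> ((x(i := v)) j)) = (\<Prod>j\<in>{..<n} - {i}. \<phi> (x j))"
      by (rule prod.cong) auto
    finally show ?thesis .
  qed
  show ?thesis
    unfolding multilinear_form_def
  proof (intro conjI allI impI)
    fix i x assume "i < n"
    show "Vector_Spaces.linear sc (*) (\<lambda>v. \<Prod>j<n. \<phi> ((x(i := v)) j))"
      unfolding eq[OF \<open>i < n\<close>]
      by unfold_locales (auto simp: l.add l.scale algebra_simps)
  qed auto
qed

lemma inj_norm_sum:
  "inj_norm sc n (\<lambda>A. \<Sum>j<k. lam j * tensor sc n (\<lambda>_. x j) A) =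
     (SUP \<phi>\<in>dual_ball sc. norm (\<Sum>j<k. lam j * \<phi> (x j) ^ n))"
  unfolding inj_norm_def
  by (intro SUP_cong refl) (auto simp: tensor_def dual_ball_def multilinear_form_prod)

end

theory Submission
  imports Defs "HOL-Computational_Algebra.Polynomial"
begin

text \<open>
  For two linearly independent functionals (resp. two linearly independent vectors) the set of pairs
  \<open>(\<phi> x, \<psi> x)\<close>, \<open>x\<close> in the unit ball (resp. \<open>(\<phi> x, \<phi> y)\<close>, \<open>\<phi>\<close> in the dual ball), is a bounded set
  of pairs of scalars. After a linear change of the two functionals (resp. vectors) it lies in the
  Euclidean unit ball and has the point \<open>(1, 0)\<close> in its closure. If \<open>|s|\<^sup>2 + |t|\<^sup>2 \<le> 1\<close> and \<open>|\<zeta>| = 1\<close>, then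
  \<open>|s\<^sup>n + \<zeta> s\<^sup>n\<^sup>-\<^sup>2 t\<^sup>2| \<le> |s|\<^sup>2 + |t|\<^sup>2 \<le> 1\<close>. Hence \<open>\<phi>\<^sup>n\<close> is a point of the unit sphere that is not extreme, with
  direction \<open>\<phi>\<^sup>n\<^sup>-\<^sup>2 \<psi>\<^sup>2\<close>; likewise for \<open>x\<^sup>n\<close>, with direction the symmetrization of \<open>x\<^sup>n\<^sup>-\<^sup>2 \<otimes> y\<^sup>2\<close>.
  Functionals are supplied by the Hahn-Banach argument that a minimal sublinear functional is linear.
\<close>

section \<open>Separation of points by functionals\<close>

definition sublinear :: "('a::real_vector \<Rightarrow> real) \<Rightarrow> bool" where
  "sublinear p \<longleftrightarrow> (\<forall>x y. p (x + y) \<le> p x + p y) \<and> (\<forall>r\<ge>0. \<forall>x. p (r *\<^sub>R x) = r * p x)"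

lemma sublinearD:
  assumes "sublinear p"
  shows "p (x + y) \<le> p x + p y" "r \<ge> 0 \<Longrightarrow> p (r *\<^sub>R x) = r * p x"
  using assms by (auto simp: sublinear_def)

lemma sublinear_zero: "sublinear p \<Longrightarrow> p 0 = 0"
  using sublinearD(2)[of p 0 0] by simp

lemma sublinear_ge: "sublinear p \<Longrightarrow> - p (- x) \<le> p x"
  using sublinearD(1)[of p x "- x"] sublinear_zero[of p] by simp

text \<open>
  The tilt of \<open>p\<close> is sublinear, lies below \<open>p\<close>, and takes a value \<open>\<le> - p y\<close> at \<open>- y\<close>. It makes a
  minimal \<open>p\<close> odd, and applied to the norm it keeps the functional below it from vanishing at \<open>y\<close>.
\<close>

definition tilt :: "('a::real_vector \<Rightarrow> real) \<Rightarrow> 'a \<Rightarrow> 'a \<Rightarrow> real" where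
  "tilt p y z = (INF t\<in>{0..}. p (z + t *\<^sub>R y) - t * p y)"

text \<open>A real \<open>INF\<close> is a lower bound only if the family is bounded below; here
  \<open>- p (- z)\<close> bounds it, because \<open>t * p y = p (t *\<^sub>R y)\<close> is at most
  \<open>p (z + t *\<^sub>R y) + p (- z)\<close>.\<close>

lemma tilt_le:
  assumes "sublinear p" "t \<ge> 0"
  shows "tilt p y z \<le> p (z + t *\<^sub>R y) - t * p y"
  unfolding tilt_def
proof (rule cINF_lower)
  show "bdd_below ((\<lambda>t. p (z + t *\<^sub>R y) - t * p y) ` {0..})"
  proof (rule bdd_belowI2)
    fix t :: real assume "t \<in> {0..}"
    then have "t * p y \<le> p (z + t *\<^sub>R y) + p (- z)"
      using sublinearD(1)[OF assms(1), of "z + t *\<^sub>R y" "- z"] sublinearD(2)[OF assms(1), of t y]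
      by simp
    then show "- p (- z) \<le> p (z + t *\<^sub>R y) - t * p y" by simp
  qed
qed (use assms in auto)

lemma tilt_greatest:
  assumes "\<And>t. t \<ge> 0 \<Longrightarrow> c \<le> p (z + t *\<^sub>R y) - t * p y"
  shows "c \<le> tilt p y z"
  unfolding tilt_def by (rule cINF_greatest) (use assms in auto)

lemma sublinear_tilt:
  assumes p: "sublinear p"
  shows "sublinear (tilt p y)"
  unfolding sublinear_def
proof (intro conjI allI impI)
  fix z w
  \<comment> \<open>If \<open>t\<close> serves \<open>z\<close> and \<open>s\<close> serves
    \<open>w\<close>, then \<open>t + s\<close> serves \<open>z + w\<close>. The infimum is taken
    over \<open>t\<close> with \<open>s\<close> fixed, and then over \<open>s\<close>.\<close>
  have "tilt p y (z + w) - (p (w + s *\<^sub>R y) - s * p y) \<le> tilt p y z" if "s \<ge> 0" for s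
  proof (rule tilt_greatest)
    fix t :: real assume "t \<ge> 0"
    have "tilt p y (z + w) \<le> p (z + w + (t + s) *\<^sub>R y) - (t + s) * p y"
      using tilt_le[OF p] \<open>t \<ge> 0\<close> \<open>s \<ge> 0\<close> by simp
    also have "z + w + (t + s) *\<^sub>R y = (z + t *\<^sub>R y) + (w + s *\<^sub>R y)"
      by (simp add: algebra_simps)
    finally show "tilt p y (z + w) - (p (w + s *\<^sub>R y) - s * p y) \<le> p (z + t *\<^sub>R y) - t * p y"
      using sublinearD(1)[OF p, of "z + t *\<^sub>R y" "w + s *\<^sub>R y"] by (simp add: algebra_simps)
  qed
  then have "tilt p y (z + w) - tilt p y z \<le> tilt p y w"
    by (intro tilt_greatest) (simp add: algebra_simps)
  then show "tilt p y (z + w) \<le> tilt p y z + tilt p y w" by simp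
next
  \<comment> \<open>One inequality for all \<open>r > 0\<close> is enough: applied to
    \<open>1 / r\<close> and \<open>r *\<^sub>R z\<close> it yields the reverse one.\<close>
  have le: "tilt p y (r *\<^sub>R z) \<le> r * tilt p y z" if "r > 0" for r z
  proof -
    have "tilt p y (r *\<^sub>R z) / r \<le> tilt p y z"
    proof (rule tilt_greatest)
      fix t :: real assume "t \<ge> 0"
      then have "tilt p y (r *\<^sub>R z) \<le> p (r *\<^sub>R z + (r * t) *\<^sub>R y) - r * t * p y"
        using tilt_le[OF p] that by simp
      also have "r *\<^sub>R z + (r * t) *\<^sub>R y = r *\<^sub>R (z + t *\<^sub>R y)"
        by (simp add: algebra_simps)
      finally show "tilt p y (r *\<^sub>R z) / r \<le> p (z + t *\<^sub>R y) - t * p y"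
        using that sublinearD(2)[OF p, of r "z + t *\<^sub>R y"] by (simp add: field_simps)
    qed
    then show ?thesis using that by (simp add: field_simps)
  qed
  fix r z assume "(r::real) \<ge> 0"
  show "tilt p y (r *\<^sub>R z) = r * tilt p y z"
  proof (cases "r = 0")
    case True
    have "tilt p y 0 \<le> 0" using tilt_le[OF p, of 0 y 0] sublinear_zero[OF p] by simp
    moreover have "0 \<le> tilt p y 0"
      by (rule tilt_greatest) (simp add: sublinearD(2)[OF p])
    ultimately show ?thesis using True by simp
  next
    case False
    then have "r > 0" using \<open>r \<ge> 0\<close> by simp
    then have "tilt p y z \<le> tilt p y (r *\<^sub>R z) / r"
      using le[of "1 / r" "r *\<^sub>R z"] by simp
    then show ?thesis using le[OF \<open>r > 0\<close>, of z] \<open>r > 0\<close> by (simp add: field_simps)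
  qed
qed

lemma tilt_below: "sublinear p \<Longrightarrow> tilt p y z \<le> p z"
  using tilt_le[of p 0 y z] by simp

lemma tilt_minus: "sublinear p \<Longrightarrow> tilt p y (- y) \<le> - p y"
  using tilt_le[of p 1 y "- y"] sublinear_zero[of p] by simp

text \<open>Minimality gives \<open>tilt p y = p\<close> for every \<open>y\<close>, hence
  \<open>p (- y) \<le> - p y\<close>, and \<open>p\<close> is odd. Oddness turns subadditivity at
  \<open>x + y\<close> and \<open>- y\<close> into the missing half of additivity and extends
  homogeneity to negative factors.\<close>

lemma linear_if_minimal_sublinear:
  assumes p: "sublinear p" and min: "\<And>q. sublinear q \<Longrightarrow> (\<And>z. q z \<le> p z) \<Longrightarrow> q = p"
  shows "linear p"
proof -
  have neg: "p (- y) = - p y" for y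
  proof -
    have "tilt p y = p" using min sublinear_tilt[OF p] tilt_below[OF p] by blast
    then show ?thesis using tilt_minus[OF p, of y] sublinear_ge[OF p, of "- y"] by simp
  qed
  show ?thesis
  proof (rule linearI)
    fix x y r
    show "p (x + y) = p x + p y"
      using sublinearD(1)[OF p, of x y] sublinearD(1)[OF p, of "x + y" "- y"] neg[of y] by simp
    show "p (r *\<^sub>R x) = r *\<^sub>R p x"
      using sublinearD(2)[OF p, of r x] sublinearD(2)[OF p, of "- r" x] neg[of "r *\<^sub>R x"]
      by (cases "r \<ge> 0") auto
  qed
qed

text \<open>The pointwise infimum works. Subadditivity has to combine one member near the infimum at
  \<open>x\<close> with another near it at \<open>y\<close>; in a chain the smaller of the two
  serves both points.\<close>

lemma sublinear_chain_Inf: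
  assumes ne: "C \<noteq> {}" and sub: "\<And>p. p \<in> C \<Longrightarrow> sublinear p"
    and chain: "\<And>p q. p \<in> C \<Longrightarrow> q \<in> C \<Longrightarrow> (\<forall>z. p z \<le> q z) \<or> (\<forall>z. q z \<le> p z)"
  obtains m where "sublinear m" "\<And>p z. p \<in> C \<Longrightarrow> m z \<le> p z"
proof
  define m where "m z = (INF p\<in>C. p z)" for z
  obtain p0 where p0: "p0 \<in> C" using ne by auto
  have bdd: "bdd_below ((\<lambda>p. p z) ` C)" for z
  proof (rule bdd_belowI2)
    fix p assume "p \<in> C"
    \<comment> \<open>A member below \<open>p0\<close> satisfies
      \<open>p z \<ge> - p (- z) \<ge> - p0 (- z)\<close>; any other member lies above
      \<open>p0\<close>.\<close>
    show "min (- p0 (- z)) (p0 z) \<le> p z"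
    proof (cases "\<forall>z. p z \<le> p0 z")
      case True
      then show ?thesis
        using sublinear_ge[OF sub[OF \<open>p \<in> C\<close>], of z] by (smt (verit))
    next
      case False
      then show ?thesis using chain[OF \<open>p \<in> C\<close> p0] by (smt (verit))
    qed
  qed
  show lower: "m z \<le> p z" if "p \<in> C" for p z
    unfolding m_def by (rule cINF_lower[OF bdd that])
  have greatest: "c \<le> m z" if "\<And>p. p \<in> C \<Longrightarrow> c \<le> p z" for c z
    unfolding m_def using ne that by (rule cINF_greatest)
  show "sublinear m"
    unfolding sublinear_def
  proof (intro conjI allI impI)
    fix x y
    have "m (x + y) - q y \<le> m x" if "q \<in> C" for q
    proof (rule greatest)
      fix p assume "p \<in> C"
      have "m (x + y) \<le> p (x + y)" "m (x + y) \<le> q (x + y)"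
        using lower \<open>p \<in> C\<close> \<open>q \<in> C\<close> by auto
      then show "m (x + y) - q y \<le> p x"
        using chain[OF \<open>p \<in> C\<close> \<open>q \<in> C\<close>] sublinearD(1)[OF sub[OF \<open>p \<in> C\<close>], of x y]
          sublinearD(1)[OF sub[OF \<open>q \<in> C\<close>], of x y] by (smt (verit))
    qed
    then have "m (x + y) - m x \<le> m y" by (intro greatest) (simp add: algebra_simps)
    then show "m (x + y) \<le> m x + m y" by simp
  next
    have le: "m (r *\<^sub>R x) \<le> r * m x" if "r > 0" for r x
    proof -
      have "m (r *\<^sub>R x) / r \<le> m x"
      proof (rule greatest)
        fix p assume "p \<in> C"
        then show "m (r *\<^sub>R x) / r \<le> p x"
          using lower[OF \<open>p \<in> C\<close>, of "r *\<^sub>R x"] sublinearD(2)[OF sub, of p r x] that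
          by (simp add: field_simps)
      qed
      then show ?thesis using that by (simp add: field_simps)
    qed
    fix r x assume "(r::real) \<ge> 0"
    show "m (r *\<^sub>R x) = r * m x"
    proof (cases "r = 0")
      case True
      have "m 0 = 0"
      proof (rule order_antisym)
        show "m 0 \<le> 0" using lower[OF p0, of 0] sublinear_zero[OF sub[OF p0]] by simp
        show "0 \<le> m 0" by (rule greatest) (simp add: sublinear_zero[OF sub])
      qed
      then show ?thesis using True by simp
    next
      case False
      then have "r > 0" using \<open>r \<ge> 0\<close> by simp
      then have "m x \<le> m (r *\<^sub>R x) / r" using le[of "1 / r" "r *\<^sub>R x"] by simp
      then show ?thesis using le[OF \<open>r > 0\<close>, of x] \<open>r > 0\<close> by (simp add: field_simps)
    qed
  qed
qed

text \<open>Zorn's lemma yields a minimal sublinear functional below \<open>p\<close>, and minimal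
  ones are linear.\<close>

lemma linear_below_sublinear:
  assumes p: "sublinear p"
  obtains f where "linear f" "\<And>z. f z \<le> p z"
proof -
  define S where "S = {q. sublinear q \<and> (\<forall>z. q z \<le> p z)}"
  \<comment> \<open>The order is reversed, so that maximal elements for \<open>R\<close> are minimal
    functionals and upper bounds of chains come from infima.\<close>
  define R where "R = {(q, q'). q \<in> S \<and> q' \<in> S \<and> (\<forall>z. q' z \<le> q z)}"
  have "antisym R"
    by (rule antisymI) (auto simp: R_def fun_eq_iff intro: order_antisym)
  then have po: "Partial_order R"
    unfolding R_def
    by (auto simp: partial_order_on_def preorder_on_def refl_on_def Field_def trans_def
        intro: order_trans)
  have field: "Field R = S" by (auto simp: R_def Field_def)
  have "\<exists>u\<in>Field R. \<forall>q\<in>C. (q, u) \<in> R" if "C \<in> Chains R" for C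
  proof (cases "C = {}")
    case True
    have "p \<in> S" using p by (simp add: S_def)
    then show ?thesis using True field by auto
  next
    case False
    have CS: "C \<subseteq> S" using that by (auto simp: Chains_def R_def)
    obtain m where m: "sublinear m" "\<And>q z. q \<in> C \<Longrightarrow> m z \<le> q z"
    proof (rule sublinear_chain_Inf[OF False])
      show "sublinear q" if "q \<in> C" for q using that CS by (auto simp: S_def)
      show "(\<forall>z. q z \<le> q' z) \<or> (\<forall>z. q' z \<le> q z)" if "q \<in> C" "q' \<in> C" for q q'
        using that \<open>C \<in> Chains R\<close> by (auto simp: Chains_def R_def)
    qed (rule that)
    obtain q where "q \<in> C" using False by auto
    then have "q z \<le> p z" for z using CS by (auto simp: S_def)
    then have "m \<in> S"
      using m(1) order_trans[OF m(2)[OF \<open>q \<in> C\<close>]] by (simp add: S_def)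
    then show ?thesis using m CS field by (auto simp: R_def)
  qed
  then obtain f where f: "f \<in> S" and max: "\<And>q. q \<in> S \<Longrightarrow> (f, q) \<in> R \<Longrightarrow> q = f"
    using Zorns_po_lemma[OF po] field by auto
  have "linear f"
  proof (rule linear_if_minimal_sublinear)
    show "sublinear f" using f by (simp add: S_def)
    fix q assume q: "sublinear q" "\<And>z. q z \<le> f z"
    then have "q \<in> S" using f by (auto simp: S_def intro: order_trans)
    then show "q = f" using max q f by (auto simp: R_def)
  qed
  then show ?thesis using that f by (auto simp: S_def)
qed

text \<open>A linear \<open>f\<close> below the tilt of the norm at \<open>x\<close> satisfies
  \<open>f (- x) \<le> - norm x\<close>, so \<open>f x \<ge> norm x > 0\<close>; as the tilt lies
  below the norm, \<open>f\<close> is bounded by it.\<close>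

lemma bounded_linear_separating:
  fixes x :: "'a::real_normed_vector"
  assumes "x \<noteq> 0"
  obtains f :: "'a \<Rightarrow> real" where "bounded_linear f" "f x \<noteq> 0"
proof -
  have sub: "sublinear (norm :: 'a \<Rightarrow> real)"
    by (simp add: sublinear_def norm_triangle_ineq)
  obtain f :: "'a \<Rightarrow> real" where f: "linear f" "\<And>z. f z \<le> tilt norm x z"
    using linear_below_sublinear[OF sublinear_tilt[OF sub]] by blast
  have le: "f z \<le> norm z" for z
    using f(2)[of z] tilt_below[OF sub, of x z] by simp
  have "\<bar>f z\<bar> \<le> norm z" for z
    using le[of z] le[of "- z"] linear_neg[OF f(1), of z] by auto
  then have "bounded_linear f"
    using f(1) by (auto simp: bounded_linear_def bounded_linear_axioms_def intro!: exI[of _ 1])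
  moreover have "f x \<noteq> 0"
    using f(2)[of "- x"] tilt_minus[OF sub, of x] linear_neg[OF f(1), of x] assms
      norm_eq_zero[of x] norm_ge_zero[of x] by linarith
  ultimately show ?thesis using that by blast
qed

section \<open>Rotating a bounded set of pairs of scalars\<close>

text \<open>\<open>cj\<close> stands for conjugation, the identity on the reals, and the assumption
  is Lagrange's identity. It lets both scalar fields share one argument; \<open>heine_borel\<close>
  supplies the compactness.\<close>

locale hermitian_scalars =
  fixes cj :: "'k::{real_normed_field,heine_borel} \<Rightarrow> 'k"
  assumes rotation: "(norm (cj a * s + cj b * t))\<^sup>2 + (norm (a * t - b * s))\<^sup>2 =
    ((norm a)\<^sup>2 + (norm b)\<^sup>2) * ((norm s)\<^sup>2 + (norm t)\<^sup>2)"
begin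

text \<open>
  Let \<open>(s, t)\<close> be a point of largest Euclidean norm in the closure of the bounded set of all
  \<open>(f i, g i)\<close>; after scaling that norm to \<open>1\<close>, rotate \<open>(s, t)\<close> to \<open>(1, 0)\<close>.
\<close>

lemma rotate_to_unit:
  fixes f g :: "'i \<Rightarrow> 'k"
  assumes bound: "\<And>i. i \<in> I \<Longrightarrow> norm (f i) \<le> K" "\<And>i. i \<in> I \<Longrightarrow> norm (g i) \<le> K"
    and i0: "i0 \<in> I" "f i0 \<noteq> 0"
  obtains a b \<alpha> \<beta> where "a \<noteq> 0 \<or> b \<noteq> 0"
    "\<And>i. i \<in> I \<Longrightarrow> (norm (\<alpha> * f i + \<beta> * g i))\<^sup>2 + (norm (a * g i - b * f i))\<^sup>2 \<le> 1"
    "\<And>m. (SUP i\<in>I. norm (\<alpha> * f i + \<beta> * g i) ^ m) = 1"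
proof -
  define D where "D = (\<lambda>i. (f i, g i)) ` I"
  have "norm p \<le> K + K" if p: "p \<in> D" for p
  proof -
    obtain i where "i \<in> I" "p = (f i, g i)" using p unfolding D_def by blast
    then show ?thesis using norm_Pair_le[of "f i" "g i"] bound[of i] by simp
  qed
  then have "bounded D" unfolding bounded_iff by blast
  then have "compact (closure D)" by (simp add: compact_closure)
  moreover have "closure D \<noteq> {}" using i0 by (auto simp: D_def)
  moreover have "continuous_on (closure D) (norm :: 'k \<times> 'k \<Rightarrow> real)"
    by (intro continuous_intros)
  ultimately obtain p where p: "p \<in> closure D" and p_max: "\<forall>q\<in>closure D. norm q \<le> norm p"
    using continuous_attains_sup by blast
  obtain s t where st: "p = (s, t)" by (cases p)
  define N where "N = (norm s)\<^sup>2 + (norm t)\<^sup>2"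
  have sq: "(norm (x, y))\<^sup>2 = (norm x)\<^sup>2 + (norm y)\<^sup>2" for x y :: 'k
    by (simp add: norm_prod_def)
  have le_N: "(norm (f i))\<^sup>2 + (norm (g i))\<^sup>2 \<le> N" if "i \<in> I" for i
  proof -
    have "(f i, g i) \<in> closure D" using that closure_subset by (force simp: D_def)
    then have "norm (f i, g i) \<le> norm p" using p_max by blast
    then have "(norm (f i, g i))\<^sup>2 \<le> (norm p)\<^sup>2" by (intro power_mono) auto
    then show ?thesis by (simp add: sq st N_def)
  qed
  have "0 < (norm (f i0))\<^sup>2 + (norm (g i0))\<^sup>2"
    using i0 by (intro add_pos_nonneg) auto
  then have N: "N > 0" using le_N[OF i0(1)] by linarith
  \<comment> \<open>The divisor \<open>N\<close> joins two factors \<open>sqrt N\<close>: one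
    normalizes the rotation, the other scales the largest norm to 1.\<close>
  define \<phi> where "\<phi> q = cj s / of_real N * fst q + cj t / of_real N * snd q" for q
  define \<psi> where "\<psi> q = s / of_real N * snd q - t / of_real N * fst q" for q
  have sum: "(norm (\<phi> q))\<^sup>2 + (norm (\<psi> q))\<^sup>2 = ((norm (fst q))\<^sup>2 + (norm (snd q))\<^sup>2) / N" for q
  proof -
    have "\<phi> q = (cj s * fst q + cj t * snd q) / of_real N"
      "\<psi> q = (s * snd q - t * fst q) / of_real N"
      by (simp_all add: \<phi>_def \<psi>_def add_divide_distrib diff_divide_distrib)
    then have "(norm (\<phi> q))\<^sup>2 + (norm (\<psi> q))\<^sup>2 =
        ((norm (cj s * fst q + cj t * snd q))\<^sup>2 + (norm (s * snd q - t * fst q))\<^sup>2) / N\<^sup>2"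
      by (simp only: norm_divide power_divide norm_of_real power2_abs add_divide_distrib[symmetric])
    then show ?thesis
      using N unfolding rotation N_def[symmetric] by (simp add: power2_eq_square)
  qed
  have le1: "(norm (\<phi> (f i, g i)))\<^sup>2 + (norm (\<psi> (f i, g i)))\<^sup>2 \<le> 1" if "i \<in> I" for i
    using le_N[OF that] N by (simp add: sum)
  have "norm (\<phi> (f i, g i)) \<le> 1" if "i \<in> I" for i
  proof -
    have "(norm (\<phi> (f i, g i)))\<^sup>2 \<le> 1"
      using le1[OF that] zero_le_power2[of "norm (\<psi> (f i, g i))"] by linarith
    then show ?thesis by (simp add: abs_square_le_1)
  qed
  then have pow_le1: "norm (\<phi> (f i, g i)) ^ m \<le> 1" if "i \<in> I" for i m
    using that by (simp add: power_le_one)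
  \<comment> \<open>Since the second coordinate of \<open>p\<close> vanishes, the identity leaves
    all of the norm to the first one. Only the modulus of \<open>\<phi> p\<close> is obtained, which
    suffices.\<close>
  have "\<psi> p = 0" by (simp add: \<psi>_def st)
  then have "(norm (\<phi> p))\<^sup>2 = 1"
    using sum[of p] N by (simp add: st N_def[symmetric])
  then have "norm (\<phi> p) = 1" by (simp add: power2_eq_1_iff) (smt (verit) norm_ge_zero)
  have "(SUP i\<in>I. norm (\<phi> (f i, g i)) ^ m) = 1" for m
  proof (rule cSup_eq_non_empty)
    show "(\<lambda>i. norm (\<phi> (f i, g i)) ^ m) ` I \<noteq> {}" using i0 by auto
    show "x \<le> 1" if "x \<in> (\<lambda>i. norm (\<phi> (f i, g i)) ^ m) ` I" for x
      using that pow_le1 by auto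
    fix u assume u: "\<And>x. x \<in> (\<lambda>i. norm (\<phi> (f i, g i)) ^ m) ` I \<Longrightarrow> x \<le> u"
    \<comment> \<open>The point \<open>p\<close> may lie outside \<open>D\<close>, so the supremum
      need not be attained; a bound valid on \<open>D\<close> passes to the closure by
      continuity.\<close>
    have "closed {q. norm (\<phi> q) ^ m \<le> u}"
      unfolding \<phi>_def by (intro closed_Collect_le continuous_intros)
    moreover have "D \<subseteq> {q. norm (\<phi> q) ^ m \<le> u}" using u by (auto simp: D_def)
    ultimately have "p \<in> {q. norm (\<phi> q) ^ m \<le> u}" using p closure_minimal by blast
    then show "1 \<le> u" using \<open>norm (\<phi> p) = 1\<close> by simp
  qed
  moreover have "s / of_real N \<noteq> 0 \<or> t / of_real N \<noteq> 0"
  proof -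
    have "s \<noteq> 0 \<or> t \<noteq> 0" using N by (auto simp: N_def)
    then show ?thesis using N by simp
  qed
  ultimately show ?thesis
    using that[of "s / of_real N" "t / of_real N" "cj s / of_real N" "cj t / of_real N"] le1
    by (simp add: \<phi>_def \<psi>_def)
qed

end

section \<open>Discs in the unit sphere\<close>

text \<open>
  An \<open>nspace\<close> carries no axioms, so \<open>smul X 1 v = v\<close> has to be part of the condition.
\<close>

definition disc_in_ball :: "('k::real_normed_field, 'v) nspace \<Rightarrow> bool" where
  "disc_in_ball X \<longleftrightarrow> (\<exists>u\<in>unit_sphere X. \<exists>v\<in>pts X. v \<noteq> vzero X \<and> smul X 1 v = v \<and>
     (\<forall>\<zeta>. norm \<zeta> = 1 \<longrightarrow> nrm X (vadd X u (smul X \<zeta> v)) \<le> 1))"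

text \<open>The scalars \<open>1\<close> and \<open>- 1\<close> on the unit circle give the two
  points \<open>vadd X u v\<close> and \<open>vsub X u v\<close>.\<close>

lemma not_strictly_convex_if_disc:
  assumes "disc_in_ball X"
  shows "\<not> strictly_convex X"
proof -
  obtain u v where uv: "u \<in> unit_sphere X" "v \<in> pts X" "v \<noteq> vzero X" "smul X 1 v = v"
    "\<And>\<zeta>. norm \<zeta> = 1 \<Longrightarrow> nrm X (vadd X u (smul X \<zeta> v)) \<le> 1"
    using assms by (auto simp: disc_in_ball_def)
  have "nrm X (vadd X u v) \<le> 1" "nrm X (vsub X u v) \<le> 1"
    using uv(4) uv(5)[of 1] uv(5)[of "- 1"] by (simp_all add: vsub_def)
  then show ?thesis using uv by (auto simp: strictly_convex_def extreme_pt_def)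
qed

lemma not_complex_strictly_convex_if_disc:
  assumes "disc_in_ball X"
  shows "\<not> complex_strictly_convex X"
proof -
  obtain u v where uv: "u \<in> unit_sphere X" "v \<in> pts X" "v \<noteq> vzero X"
    "\<And>\<zeta>. cmod \<zeta> = 1 \<Longrightarrow> nrm X (vadd X u (smul X \<zeta> v)) \<le> 1"
    using assms by (auto simp: disc_in_ball_def)
  have "{\<zeta>. cmod \<zeta> = 1} \<noteq> {}" using norm_one by blast
  then have "(SUP \<zeta>\<in>{\<zeta>. cmod \<zeta> = 1}. nrm X (vadd X u (smul X \<zeta> v))) \<le> 1"
    using uv(4) by (intro cSUP_least) auto
  then show ?thesis using uv by (auto simp: complex_strictly_convex_def complex_extreme_pt_def)
qed

section \<open>Completions of seminormed spaces of functions\<close>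

locale seminormed_functions =
  fixes S :: "('d \<Rightarrow> 'k::real_normed_field) set" and N :: "('d \<Rightarrow> 'k) \<Rightarrow> real"
    and X :: "('k, 'd \<Rightarrow> 'k) nspace"
  assumes X: "X = \<lparr>pts = S, vadd = (\<lambda>u v A. u A + v A), vzero = (\<lambda>A. 0),
      smul = (\<lambda>c u A. c * u A), nrm = N\<rparr>"
    and zero_mem: "(\<lambda>A. 0) \<in> S"
    and add_mem: "u \<in> S \<Longrightarrow> v \<in> S \<Longrightarrow> (\<lambda>A. u A + v A) \<in> S"
    and scale_mem: "u \<in> S \<Longrightarrow> (\<lambda>A. c * u A) \<in> S"
    and N_scale: "u \<in> S \<Longrightarrow> N (\<lambda>A. c * u A) = norm c * N u"
    and N_add: "u \<in> S \<Longrightarrow> v \<in> S \<Longrightarrow> N (\<lambda>A. u A + v A) \<le> N u + N v"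
begin

definition d :: "('d \<Rightarrow> 'k) \<Rightarrow> ('d \<Rightarrow> 'k) \<Rightarrow> real" where
  "d u v = N (\<lambda>A. u A - v A)"

definition emb :: "('d \<Rightarrow> 'k) \<Rightarrow> (nat \<Rightarrow> 'd \<Rightarrow> 'k) set" where
  "emb u = null_rel X `` {\<lambda>_. u}"

lemma X_simps: "pts X = S" "vadd X u v = (\<lambda>A. u A + v A)" "vzero X = (\<lambda>A. 0)"
    "smul X c u = (\<lambda>A. c * u A)" "nrm X = N"
  by (simp_all add: X)

lemma diff_mem: "u \<in> S \<Longrightarrow> v \<in> S \<Longrightarrow> (\<lambda>A. u A - v A) \<in> S"
  using add_mem[OF _ scale_mem[of v "- 1"], of u] by simp

lemma nrm_vsub: "nrm X (vsub X u v) = d u v"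
  by (simp add: X vsub_def d_def)

lemma N_zero: "N (\<lambda>A. 0) = 0"
  using N_scale[OF zero_mem, of 0] by simp

lemma N_nonneg: "u \<in> S \<Longrightarrow> 0 \<le> N u"
  using N_add[of u "\<lambda>A. - 1 * u A"] N_scale[of u "- 1"] scale_mem[of u "- 1"] N_zero by simp

lemma d_refl: "d u u = 0"
  by (simp add: d_def N_zero)

lemma d_nonneg: "u \<in> S \<Longrightarrow> v \<in> S \<Longrightarrow> 0 \<le> d u v"
  by (simp add: d_def N_nonneg diff_mem)

lemma d_commute: "u \<in> S \<Longrightarrow> v \<in> S \<Longrightarrow> d u v = d v u"
  using N_scale[OF diff_mem, of u v "- 1"] by (simp add: d_def)

lemma d_triangle: "u \<in> S \<Longrightarrow> v \<in> S \<Longrightarrow> w \<in> S \<Longrightarrow> d u w \<le> d u v + d v w"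
  using N_add[OF diff_mem diff_mem, of u v v w] by (simp add: d_def)

lemma N_diff_le:
  assumes "u \<in> S" "v \<in> S"
  shows "\<bar>N v - N u\<bar> \<le> d u v"
  using N_add[OF diff_mem[OF assms] assms(2)] N_add[OF diff_mem[OF assms(2,1)] assms(1)]
    d_commute[OF assms]
  by (simp add: d_def)

lemma d_add_le:
  assumes "u \<in> S" "v \<in> S" "u' \<in> S" "v' \<in> S"
  shows "d (\<lambda>A. u A + v A) (\<lambda>A. u' A + v' A) \<le> d u u' + d v v'"
  using N_add[OF diff_mem[of u u'] diff_mem[of v v']] assms by (simp add: d_def algebra_simps)

lemma d_scale: "u \<in> S \<Longrightarrow> v \<in> S \<Longrightarrow> d (\<lambda>A. c * u A) (\<lambda>A. c * v A) = norm c * d u v"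
  using N_scale[OF diff_mem, of u v c] by (simp add: d_def algebra_simps)

lemma cauchy_seqsD: "s \<in> cauchy_seqs X \<Longrightarrow> s i \<in> S"
  by (simp add: cauchy_seqs_def X_simps)

lemma null_rel_iff:
  "(s, t) \<in> null_rel X \<longleftrightarrow>
    s \<in> cauchy_seqs X \<and> t \<in> cauchy_seqs X \<and> (\<lambda>i. d (s i) (t i)) \<longlonglongrightarrow> 0"
  by (simp add: null_rel_def nrm_vsub)

lemma equiv_null_rel: "equiv (cauchy_seqs X) (null_rel X)"
proof (rule equivI)
  show "null_rel X \<subseteq> cauchy_seqs X \<times> cauchy_seqs X" by (auto simp: null_rel_iff)
  show "refl_on (cauchy_seqs X) (null_rel X)" by (auto simp: refl_on_def null_rel_iff d_refl)
  show "sym (null_rel X)"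
    by (rule symI) (auto simp: null_rel_iff d_commute[OF cauchy_seqsD cauchy_seqsD])
  show "trans (null_rel X)"
  proof (rule transI)
    fix s t r assume st: "(s, t) \<in> null_rel X" "(t, r) \<in> null_rel X"
    then have mem: "s i \<in> S" "t i \<in> S" "r i \<in> S" for i
      by (auto simp: null_rel_iff intro: cauchy_seqsD)
    have "(\<lambda>i. d (s i) (t i) + d (t i) (r i)) \<longlonglongrightarrow> 0"
      using st tendsto_add[of "\<lambda>i. d (s i) (t i)" 0 sequentially "\<lambda>i. d (t i) (r i)" 0]
      by (simp add: null_rel_iff)
    then have "(\<lambda>i. d (s i) (r i)) \<longlonglongrightarrow> 0"
      by (rule tendsto_sandwich[OF _ _ tendsto_const, rotated 2])
        (auto intro!: always_eventually d_nonneg d_triangle mem)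
    then show "(s, r) \<in> null_rel X" using st by (simp add: null_rel_iff)
  qed
qed

lemma const_cauchy: "u \<in> S \<Longrightarrow> (\<lambda>_. u) \<in> cauchy_seqs X"
  unfolding cauchy_seqs_def nrm_vsub by (simp add: X_simps d_refl)

text \<open>Convergence to \<open>u\<close> already implies the Cauchy property, so membership in
  the class of a constant sequence reduces to a single limit.\<close>

lemma mem_emb_iff:
  assumes "u \<in> S"
  shows "s \<in> emb u \<longleftrightarrow> (\<forall>i. s i \<in> S) \<and> (\<lambda>i. d u (s i)) \<longlonglongrightarrow> 0"
proof
  assume "s \<in> emb u"
  then show "(\<forall>i. s i \<in> S) \<and> (\<lambda>i. d u (s i)) \<longlonglongrightarrow> 0"
    by (auto simp: emb_def null_rel_iff intro: cauchy_seqsD)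
next
  assume s: "(\<forall>i. s i \<in> S) \<and> (\<lambda>i. d u (s i)) \<longlonglongrightarrow> 0"
  have "\<exists>M. \<forall>i\<ge>M. \<forall>j\<ge>M. d (s i) (s j) < e" if "e > 0" for e
  proof -
    have "eventually (\<lambda>i. d u (s i) < e / 2) sequentially"
      using s that by (intro order_tendstoD) auto
    then obtain M where M: "\<And>i. i \<ge> M \<Longrightarrow> d u (s i) < e / 2"
      by (auto simp: eventually_sequentially)
    have "d (s i) (s j) < e" if "i \<ge> M" "j \<ge> M" for i j
      using M[OF that(1)] M[OF that(2)] d_triangle[of "s i" u "s j"] d_commute[of u "s i"] s assms
      by fastforce
    then show ?thesis by blast
  qed
  then have "s \<in> cauchy_seqs X"
    using s unfolding cauchy_seqs_def nrm_vsub by (simp add: X_simps)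
  then show "s \<in> emb u"
    using s const_cauchy[OF assms] by (simp add: emb_def null_rel_iff)
qed

lemma const_mem_emb: "u \<in> S \<Longrightarrow> (\<lambda>_. u) \<in> emb u"
  by (simp add: mem_emb_iff d_refl)

lemma class_of_mem_emb: "s \<in> emb u \<Longrightarrow> null_rel X `` {s} = emb u"
  unfolding emb_def using equiv_class_eq[OF equiv_null_rel] by (auto simp: emb_def)

lemma emb_mem_completion: "u \<in> S \<Longrightarrow> emb u \<in> pts (completion X)"
  unfolding completion_def emb_def by (simp add: quotientI const_cauchy)

lemma emb_zero: "vzero (completion X) = emb (\<lambda>A. 0)"
  by (simp add: completion_def emb_def X_simps)

text \<open>Sums of representatives converge to the sum of the limits, so every class in the double
  union is the same one.\<close>

lemma emb_add:
  assumes u: "u \<in> S" and v: "v \<in> S"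
  shows "vadd (completion X) (emb u) (emb v) = emb (\<lambda>A. u A + v A)"
proof -
  have *: "null_rel X `` {\<lambda>i. vadd X (s i) (t i)} = emb (\<lambda>A. u A + v A)"
    if "s \<in> emb u" "t \<in> emb v" for s t
  proof (rule class_of_mem_emb)
    have mem: "s i \<in> S" "t i \<in> S" for i
      using that by (auto simp: mem_emb_iff u v)
    have "(\<lambda>i. d u (s i) + d v (t i)) \<longlonglongrightarrow> 0"
      using that tendsto_add[of "\<lambda>i. d u (s i)" 0 sequentially "\<lambda>i. d v (t i)" 0]
      by (simp add: mem_emb_iff u v)
    then have "(\<lambda>i. d (\<lambda>A. u A + v A) (\<lambda>A. s i A + t i A)) \<longlonglongrightarrow> 0"
      by (rule tendsto_sandwich[OF _ _ tendsto_const, rotated 2])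
        (auto intro!: always_eventually d_nonneg d_add_le add_mem mem u v)
    then show "(\<lambda>i. vadd X (s i) (t i)) \<in> emb (\<lambda>A. u A + v A)"
      by (simp add: mem_emb_iff add_mem u v mem X_simps)
  qed
  have "(\<Union>t\<in>emb v. null_rel X `` {\<lambda>i. vadd X (s i) (t i)}) = emb (\<lambda>A. u A + v A)"
    if "s \<in> emb u" for s
    by (rule UN_constant_eq[OF const_mem_emb[OF v]]) (use * that in blast)
  then have "(\<Union>s\<in>emb u. \<Union>t\<in>emb v. null_rel X `` {\<lambda>i. vadd X (s i) (t i)}) =
      emb (\<lambda>A. u A + v A)"
    by (intro UN_constant_eq[OF const_mem_emb[OF u]]) blast
  then show ?thesis by (simp add: completion_def)
qed

lemma emb_scale:
  assumes u: "u \<in> S"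
  shows "smul (completion X) c (emb u) = emb (\<lambda>A. c * u A)"
proof -
  have "null_rel X `` {\<lambda>i. smul X c (s i)} = emb (\<lambda>A. c * u A)" if "s \<in> emb u" for s
  proof (rule class_of_mem_emb)
    have mem: "s i \<in> S" for i
      using that by (auto simp: mem_emb_iff u)
    have "(\<lambda>i. norm c * d u (s i)) \<longlonglongrightarrow> 0"
      using that tendsto_mult_left[of "\<lambda>i. d u (s i)" 0 sequentially "norm c"]
      by (simp add: mem_emb_iff u)
    then show "(\<lambda>i. smul X c (s i)) \<in> emb (\<lambda>A. c * u A)"
      by (simp add: mem_emb_iff scale_mem u mem X_simps d_scale)
  qed
  then have "(\<Union>s\<in>emb u. null_rel X `` {\<lambda>i. smul X c (s i)}) = emb (\<lambda>A. c * u A)"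
    by (intro UN_constant_eq[OF const_mem_emb[OF u]]) blast
  then show ?thesis by (simp add: completion_def)
qed

lemma nrm_emb:
  assumes u: "u \<in> S"
  shows "nrm (completion X) (emb u) = N u"
proof -
  have "(THE L. \<forall>s\<in>emb u. (\<lambda>i. N (s i)) \<longlonglongrightarrow> L) = N u"
  proof (rule the_equality)
    show "\<forall>s\<in>emb u. (\<lambda>i. N (s i)) \<longlonglongrightarrow> N u"
    proof
      fix s assume "s \<in> emb u"
      then have s: "\<And>i. s i \<in> S" "(\<lambda>i. d u (s i)) \<longlonglongrightarrow> 0"
        by (auto simp: mem_emb_iff u)
      have "(\<lambda>i. N (s i) - N u) \<longlonglongrightarrow> 0"
        by (rule Lim_null_comparison[OF _ s(2)])
          (auto intro!: always_eventually N_diff_le u s)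
      then show "(\<lambda>i. N (s i)) \<longlonglongrightarrow> N u" by (simp add: LIM_zero_iff)
    qed
    \<comment> \<open>The constant sequence is itself a representative and determines the
      limit.\<close>
    show "L = N u" if "\<forall>s\<in>emb u. (\<lambda>i. N (s i)) \<longlonglongrightarrow> L" for L
      using that const_mem_emb[OF u] by (force simp: LIMSEQ_const_iff)
  qed
  then show ?thesis by (simp add: completion_def X_simps)
qed

text \<open>The canonical map \<open>emb\<close> respects the operations and carries
  \<open>N\<close> to the norm, so a disc may be exhibited before completing. As classes merge
  elements at distance zero, nonvanishing of the direction is expressed by
  \<open>N v \<noteq> 0\<close>.\<close>

lemma disc_in_completion:
  assumes u: "u \<in> S" "N u = 1" and v: "v \<in> S" "N v \<noteq> 0"
    and le: "\<And>\<zeta>. norm \<zeta> = 1 \<Longrightarrow> N (\<lambda>A. u A + \<zeta> * v A) \<le> 1"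
  shows "disc_in_ball (completion X)"
  unfolding disc_in_ball_def
proof (intro bexI conjI allI impI)
  show "emb u \<in> unit_sphere (completion X)"
    using u by (simp add: unit_sphere_def emb_mem_completion nrm_emb)
  show "emb v \<in> pts (completion X)" using v by (simp add: emb_mem_completion)
  show "emb v \<noteq> vzero (completion X)"
  proof
    assume "emb v = vzero (completion X)"
    then have "(\<lambda>_. v) \<in> emb (\<lambda>A. 0)" using const_mem_emb[OF v(1)] by (simp add: emb_zero)
    then have "d v (\<lambda>A. 0) = 0"
      by (simp add: mem_emb_iff zero_mem LIMSEQ_const_iff d_commute[OF zero_mem v(1)])
    then show False using v(2) by (simp add: d_def)
  qed
  show "smul (completion X) 1 (emb v) = emb v" using v by (simp add: emb_scale)
  fix \<zeta> :: 'k assume "norm \<zeta> = 1"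
  then show "nrm (completion X) (vadd (completion X) (emb u) (smul (completion X) \<zeta> (emb v))) \<le> 1"
    using le u v by (simp add: emb_scale emb_add scale_mem add_mem nrm_emb)
qed

end

section \<open>Interpolation weights\<close>

text \<open>The weights are the coefficients at degree \<open>m\<close> of the Lagrange basis
  polynomials for the nodes \<open>0, ..., n\<close>. Monomials of degree at most \<open>n\<close>
  are interpolated exactly, so the weights extract the coefficient at degree \<open>m\<close> from
  the values at the nodes.\<close>

lemma interpolation_weights:
  obtains w :: "nat \<Rightarrow> 'k::field_char_0"
  where "\<And>i. i \<le> n \<Longrightarrow> (\<Sum>j\<le>n. w j * of_nat j ^ i) = (if i = m then 1 else 0)"
proof
  define L :: "nat \<Rightarrow> 'k poly"
    where "L j = (\<Prod>i\<in>{..n} - {j}. smult (1 / (of_nat j - of_nat i)) [:- of_nat i, 1:])" for j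
  have deg: "degree (L j) \<le> n" if "j \<le> n" for j
  proof -
    have "degree (L j) \<le>
        (\<Sum>i\<in>{..n} - {j}. degree (smult (1 / (of_nat j - of_nat i)) [:- of_nat i, 1::'k:]))"
      unfolding L_def
      by (rule order_trans[OF degree_prod_sum_le])
        (simp_all only: comp_def finite_Diff finite_atMost order_refl)
    also have "\<dots> \<le> (\<Sum>i\<in>{..n} - {j}. 1)" by (rule sum_mono) simp
    finally show ?thesis using that by simp
  qed
  have eval: "poly (L j) (of_nat k) = (if k = j then 1 else 0)" if "k \<le> n" for j k
  proof (cases "k = j")
    case True
    have "poly (L j) (of_nat k) = (\<Prod>i\<in>{..n} - {j}. 1)"
      unfolding L_def poly_prod by (rule prod.cong) (auto simp: True diff_divide_distrib[symmetric])
    then show ?thesis using True by simp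
  next
    case False
    then have "k \<in> {..n} - {j}" using that by simp
    then have "poly (L j) (of_nat k) = 0"
      unfolding L_def poly_prod by (intro prod_zero) auto
    then show ?thesis using False by simp
  qed
  fix i assume i: "i \<le> n"
  \<comment> \<open>Both sides have degree at most \<open>n\<close> and agree at
    \<open>n + 1\<close> nodes, distinct in characteristic 0.\<close>
  have "(\<Sum>j\<le>n. smult (of_nat j ^ i) (L j)) = monom 1 i"
  proof (rule poly_eqI_degree)
    show "poly (\<Sum>j\<le>n. smult (of_nat j ^ i) (L j)) x = poly (monom 1 i) x"
      if "x \<in> of_nat ` {..n}" for x
    proof -
      obtain k where k: "x = of_nat k" "k \<le> n" using \<open>x \<in> of_nat ` {..n}\<close> by auto
      have "poly (\<Sum>j\<le>n. smult (of_nat j ^ i) (L j)) x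
          = (\<Sum>j\<le>n. if j = k then of_nat j ^ i else 0)"
        unfolding poly_sum by (rule sum.cong) (auto simp: k eval)
      also have "\<dots> = of_nat k ^ i" using k by (subst sum.delta) auto
      finally show ?thesis by (simp add: k poly_monom)
    qed
    have card: "card (of_nat ` {..n} :: 'k set) = Suc n"
      by (subst card_image) (auto simp: inj_on_def)
    have "degree (\<Sum>j\<le>n. smult (of_nat j ^ i) (L j)) \<le> n"
      by (rule degree_sum_le) (simp_all add: deg)
    then show "degree (\<Sum>j\<le>n. smult (of_nat j ^ i) (L j)) < card (of_nat ` {..n} :: 'k set)"
      by (simp add: card)
    show "degree (monom (1::'k) i) < card (of_nat ` {..n} :: 'k set)"
      using i by (simp add: card degree_monom_eq)
  qed
  then have "(\<Sum>j\<le>n. of_nat j ^ i * coeff (L j) m) = coeff (monom 1 i) m"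
    by (metis (no_types, lifting) coeff_smult coeff_sum sum.cong)
  then show "(\<Sum>j\<le>n. coeff (L j) m * of_nat j ^ i) = (if i = m then 1 else 0)"
    by (simp add: mult.commute)
qed

section \<open>Spaces with a separating dual\<close>

context banach_over
begin

definition functional :: "('a \<Rightarrow> 'k) \<Rightarrow> bool" where
  "functional \<phi> \<longleftrightarrow> Vector_Spaces.linear sc (*) \<phi> \<and> bounded_linear \<phi>"

lemma functionalD:
  assumes "functional \<phi>"
  shows "\<phi> (x + y) = \<phi> x + \<phi> y" "\<phi> (sc c x) = c * \<phi> x" "\<phi> 0 = 0"
proof -
  show "\<phi> (x + y) = \<phi> x + \<phi> y" "\<phi> (sc c x) = c * \<phi> x" for x y c
    using assms Vector_Spaces.linear_iff[of sc "(*)" \<phi>] by (auto simp: functional_def)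
  from this(2)[of 0 0] show "\<phi> 0 = 0" by simp
qed

lemma functionalI:
  assumes add: "\<And>x y. \<phi> (x + y) = \<phi> x + \<phi> y" and scale: "\<And>c x. \<phi> (sc c x) = c * \<phi> x"
    and bound: "\<And>x. norm (\<phi> x) \<le> norm x * K"
  shows "functional \<phi>"
proof -
  have "vector_space ((*) :: 'k \<Rightarrow> 'k \<Rightarrow> 'k)"
    by unfold_locales (auto simp: algebra_simps)
  then have "Vector_Spaces.linear sc (*) \<phi>"
    using vector_space_axioms add scale by (simp add: Vector_Spaces.linear_iff)
  moreover have "bounded_linear \<phi>"
  proof (rule bounded_linear_intro)
    show "\<phi> (r *\<^sub>R x) = r *\<^sub>R \<phi> x" for r x
      using scale[of "of_real r" x] by (simp add: scale_of_real scaleR_conv_of_real)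
  qed (use add bound in auto)
  ultimately show ?thesis by (simp add: functional_def)
qed

lemma functional_bound:
  assumes "functional \<phi>"
  obtains K where "K > 0" "\<And>x. norm (\<phi> x) \<le> norm x * K"
  using assms bounded_linear.pos_bounded unfolding functional_def by blast

lemma functional_combination:
  assumes \<phi>: "functional \<phi>" and \<psi>: "functional \<psi>"
  shows "functional (\<lambda>x. a * \<phi> x + b * \<psi> x)"
proof -
  obtain K L where "\<And>x. norm (\<phi> x) \<le> norm x * K" "\<And>x. norm (\<psi> x) \<le> norm x * L"
    using functional_bound[OF \<phi>] functional_bound[OF \<psi>] by metis
  then have "norm (a * \<phi> x) \<le> norm a * (norm x * K)" "norm (b * \<psi> x) \<le> norm b * (norm x * L)"
    for x by (simp_all add: norm_mult mult_left_mono)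
  then have "norm (a * \<phi> x + b * \<psi> x) \<le> norm x * (norm a * K + norm b * L)" for x
    using norm_triangle_ineq[of "a * \<phi> x" "b * \<psi> x"] by (simp add: algebra_simps) (smt (verit))
  then show ?thesis
    by (intro functionalI[where K = "norm a * K + norm b * L"])
      (auto simp: functionalD[OF \<phi>] functionalD[OF \<psi>] algebra_simps)
qed

lemma dual_ballD:
  assumes "\<phi> \<in> dual_ball sc"
  shows "functional \<phi>" "norm (\<phi> x) \<le> norm x"
proof -
  have "bounded_linear \<phi>" "onorm \<phi> \<le> 1" using assms by (auto simp: dual_ball_def)
  then show "norm (\<phi> x) \<le> norm x"
    using onorm[of \<phi> x] mult_right_mono[of "onorm \<phi>" 1 "norm x"] by simp
qed (use assms in \<open>simp add: dual_ball_def functional_def\<close>)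

lemma dual_ballI:
  assumes "functional \<phi>" "\<And>x. norm (\<phi> x) \<le> norm x"
  shows "\<phi> \<in> dual_ball sc"
  using assms onorm_bound[of 1 \<phi>] by (simp add: dual_ball_def functional_def)

lemma zero_in_dual_ball: "(\<lambda>x. 0) \<in> dual_ball sc"
  by (intro dual_ballI functionalI[where K = 0]) auto

lemma scale_into_dual_ball:
  assumes \<phi>: "functional \<phi>"
  obtains c where "c \<noteq> 0" "(\<lambda>x. c * \<phi> x) \<in> dual_ball sc"
proof -
  obtain K where K: "K > 0" "\<And>x. norm (\<phi> x) \<le> norm x * K"
    using functional_bound[OF \<phi>] by blast
  have "(\<lambda>x. of_real (1 / K) * \<phi> x) \<in> dual_ball sc"
  proof (rule dual_ballI)
    show "functional (\<lambda>x. of_real (1 / K) * \<phi> x)"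
      using functional_combination[OF \<phi> \<phi>, of "of_real (1 / K)" 0] by simp
    show "norm (of_real (1 / K) * \<phi> x) \<le> norm x" for x
      using K by (simp add: norm_mult norm_divide field_simps)
  qed
  then show ?thesis using that[of "of_real (1 / K)"] K(1) by simp
qed

lemma independent_pair:
  assumes "\<exists>B. card B = 2 \<and> \<not> dependent B"
  obtains x y where "\<And>a b. sc a x + sc b y = 0 \<Longrightarrow> a = 0 \<and> b = 0"
proof -
  obtain x y where xy: "x \<noteq> y" "\<not> dependent {x, y}"
    using assms by (auto simp: card_2_iff)
  have "a = 0 \<and> b = 0" if "sc a x + sc b y = 0" for a b
  proof (rule ccontr)
    assume "\<not> (a = 0 \<and> b = 0)"
    then have "dependent {x, y}"
      using that xy(1)
      by (subst dependent_finite) (auto intro!: exI[of _ "\<lambda>v. if v = x then a else b"])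
    then show False using xy(2) by blast
  qed
  then show ?thesis using that by blast
qed

text \<open>With all slots but \<open>i\<close> fixed, the product is a constant multiple of
  \<open>\<theta> i\<close>. Different functionals in different slots are needed for products of
  powers of two functionals.\<close>

lemma multilinear_form_prod_functionals:
  assumes "\<And>i. i < n \<Longrightarrow> functional (\<theta> i)"
  shows "multilinear_form sc n (\<lambda>x. \<Prod>i<n. \<theta> i (x i))"
proof -
  have eq: "(\<Prod>j<n. \<theta> j ((x(i := v)) j)) = \<theta> i v * (\<Prod>j\<in>{..<n} - {i}. \<theta> j (x j))"
    if "i < n" for i v and x :: "nat \<Rightarrow> 'a"
  proof -
    have "(\<Prod>j<n. \<theta> j ((x(i := v)) j)) = \<theta> i v * (\<Prod>j\<in>{..<n} - {i}. \<theta> j ((x(i := v)) j))"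
      using that by (subst prod.remove[where x = i]) auto
    also have "(\<Prod>j\<in>{..<n} - {i}. \<theta> j ((x(i := v)) j)) = (\<Prod>j\<in>{..<n} - {i}. \<theta> j (x j))"
      by (rule prod.cong) auto
    finally show ?thesis .
  qed
  show ?thesis
    unfolding multilinear_form_def
  proof (intro conjI allI impI)
    fix i x assume i: "i < n"
    show "Vector_Spaces.linear sc (*) (\<lambda>v. \<Prod>j<n. \<theta> j ((x(i := v)) j))"
      unfolding eq[OF i]
      by unfold_locales (auto simp: functionalD[OF assms[OF i]] algebra_simps)
  qed auto
qed

end

text \<open>Gathers what the real and complex cases have in common: the rotation identity and enough
  functionals to separate points from zero.\<close>

locale separated_space = banach_over sc + hermitian_scalars cj
  for sc :: "'k::{real_normed_field,heine_borel} \<Rightarrow> 'a::banach \<Rightarrow> 'a"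
    and cj :: "'k \<Rightarrow> 'k" +
  assumes separation: "x \<noteq> 0 \<Longrightarrow> \<exists>\<phi>. functional \<phi> \<and> \<phi> x \<noteq> 0"
begin

text \<open>The values at \<open>x\<close> and \<open>z\<close> form a triangular matrix with
  nonzero diagonal, which makes \<open>\<phi>\<close> and \<open>\<psi>\<close> linearly
  independent.\<close>

lemma triangular_functionals:
  assumes ind: "\<And>a b. sc a x + sc b y = 0 \<Longrightarrow> a = 0 \<and> b = 0"
  obtains \<phi> \<psi> z where "functional \<phi>" "functional \<psi>" "\<phi> x \<noteq> 0" "\<phi> z = 0" "\<psi> z \<noteq> 0"
proof -
  have "x \<noteq> 0" using ind[of 1 0] by auto
  then obtain \<phi> where \<phi>: "functional \<phi>" "\<phi> x \<noteq> 0" using separation by blast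
  \<comment> \<open>An elimination step: \<open>y\<close> is corrected by the multiple of
    \<open>x\<close> that makes \<open>\<phi>\<close> vanish; independence keeps the result
    nonzero.\<close>
  define z where "z = sc (- \<phi> y / \<phi> x) x + sc 1 y"
  have "z \<noteq> 0" using ind[of "- \<phi> y / \<phi> x" 1] by (auto simp: z_def)
  then obtain \<psi> where "functional \<psi>" "\<psi> z \<noteq> 0" using separation by blast
  moreover have "\<phi> z = - \<phi> y / \<phi> x * \<phi> x + 1 * \<phi> y"
    unfolding z_def by (simp only: functionalD[OF \<phi>(1)])
  then have "\<phi> z = 0" using \<phi>(2) by simp
  ultimately show ?thesis using that \<phi> by blast
qed

text \<open>If neither \<open>x\<close> nor \<open>y\<close> works, then \<open>\<psi> x = 0\<close>
  and \<open>\<phi> y = 0\<close>, so \<open>x + y\<close> works.\<close>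

lemma common_nonzero_point:
  assumes "functional \<phi>" "functional \<psi>" "\<phi> x \<noteq> 0" "\<psi> y \<noteq> 0"
  obtains z where "\<phi> z \<noteq> 0" "\<psi> z \<noteq> 0"
  using that[of x] that[of y] that[of "x + y"] assms
  by (cases "\<psi> x = 0"; cases "\<phi> y = 0") (auto simp: functionalD)

text \<open>The same trick on the dual side: one of \<open>\<phi>\<close>, \<open>\<psi>\<close> and
  their sum works, up to scaling into the dual ball.\<close>

lemma common_nonzero_functional:
  assumes "x \<noteq> 0" "y \<noteq> 0"
  obtains \<phi> where "\<phi> \<in> dual_ball sc" "\<phi> x \<noteq> 0" "\<phi> y \<noteq> 0"
proof -
  obtain \<phi> \<psi> where \<phi>: "functional \<phi>" "\<phi> x \<noteq> 0" and \<psi>: "functional \<psi>" "\<psi> y \<noteq> 0"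
    using separation assms by meson
  have "functional (\<lambda>z. 1 * \<phi> z + 1 * \<psi> z)" using functional_combination \<phi> \<psi> by blast
  then obtain \<theta> where \<theta>: "functional \<theta>" "\<theta> x \<noteq> 0" "\<theta> y \<noteq> 0"
    using \<phi> \<psi> by (cases "\<psi> x = 0"; cases "\<phi> y = 0") force+
  then obtain c where "c \<noteq> 0" "(\<lambda>x. c * \<theta> x) \<in> dual_ball sc"
    using scale_into_dual_ball by blast
  then show ?thesis using that[of "\<lambda>x. c * \<theta> x"] \<theta> by simp
qed

section \<open>Homogeneous polynomials\<close>

text \<open>Factoring out \<open>p ^ (n - 2)\<close>, of norm at most 1, leaves the quadratic case,
  which is the triangle inequality.\<close>

lemma norm_disc_le:
  fixes p q \<zeta> :: 'k
  assumes "(norm p)\<^sup>2 + (norm q)\<^sup>2 \<le> 1" "norm \<zeta> = 1" "n \<ge> 2"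
  shows "norm (p ^ n + \<zeta> * (p ^ (n - 2) * q\<^sup>2)) \<le> 1"
proof -
  have n: "n = (n - 2) + 2" using assms by simp
  have "p ^ n = p ^ (n - 2) * p\<^sup>2" by (subst n) (rule power_add)
  then have "norm (p ^ n + \<zeta> * (p ^ (n - 2) * q\<^sup>2)) = norm p ^ (n - 2) * norm (p\<^sup>2 + \<zeta> * q\<^sup>2)"
    by (simp add: norm_mult[symmetric] norm_power[symmetric] algebra_simps)
  also have "\<dots> \<le> 1 * 1"
  proof (rule mult_mono)
    have "(norm p)\<^sup>2 \<le> 1" using assms(1) zero_le_power2[of "norm q"] by linarith
    then have "norm p \<le> 1" by (simp add: abs_square_le_1)
    then show "norm p ^ (n - 2) \<le> 1" by (simp add: power_le_one)
    have "norm (p\<^sup>2 + \<zeta> * q\<^sup>2) \<le> (norm p)\<^sup>2 + (norm q)\<^sup>2"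
      using norm_triangle_ineq[of "p\<^sup>2" "\<zeta> * q\<^sup>2"] assms(2) by (simp add: norm_mult norm_power)
    then show "norm (p\<^sup>2 + \<zeta> * q\<^sup>2) \<le> 1" using assms(1) by linarith
  qed auto
  finally show ?thesis by simp
qed

lemma homogeneous_poly_prod:
  assumes "functional \<phi>" "functional \<psi>" "k \<le> n"
  shows "(\<lambda>x. \<phi> x ^ (n - k) * \<psi> x ^ k) \<in> homogeneous_polys sc n"
  unfolding homogeneous_polys_def
proof (intro CollectI conjI exI allI)
  have "continuous_on UNIV \<phi>" "continuous_on UNIV \<psi>"
    using assms by (auto simp: functional_def linear_continuous_on)
  then show "continuous_on UNIV (\<lambda>x. \<phi> x ^ (n - k) * \<psi> x ^ k)"
    by (intro continuous_intros)
  \<comment> \<open>The form need not be symmetric: the first \<open>k\<close> slots receive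
    \<open>\<psi>\<close>, the others \<open>\<phi>\<close>.\<close>
  define \<theta> where "\<theta> i = (if i < k then \<psi> else \<phi>)" for i
  show "multilinear_form sc n (\<lambda>x. \<Prod>i<n. \<theta> i (x i))"
    by (rule multilinear_form_prod_functionals) (simp add: \<theta>_def assms)
  fix x
  have "(\<Prod>i<n. \<theta> i x) = (\<Prod>i\<in>{..<k} \<union> {k..<n}. \<theta> i x)"
    using assms(3) by (simp add: ivl_disj_un)
  also have "\<dots> = (\<Prod>i<k. \<theta> i x) * (\<Prod>i=k..<n. \<theta> i x)"
    by (rule prod.union_disjoint) auto
  also have "\<dots> = \<psi> x ^ k * \<phi> x ^ (n - k)"
    by (simp add: \<theta>_def)
  finally show "\<phi> x ^ (n - k) * \<psi> x ^ k = (\<Prod>i<n. \<theta> i x)"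
    by (simp add: mult.commute)
qed

lemma disc_in_poly_space:
  assumes ind: "\<And>a b. sc a x + sc b y = 0 \<Longrightarrow> a = 0 \<and> b = 0" and n: "n \<ge> 2"
  shows "disc_in_ball (poly_space sc n)"
proof -
  obtain \<phi> \<psi> z where fg: "functional \<phi>" "functional \<psi>" "\<phi> x \<noteq> 0" "\<phi> z = 0" "\<psi> z \<noteq> 0"
    using triangular_functionals[OF ind] by blast
  obtain K L where K: "K > 0" "\<And>x. norm (\<phi> x) \<le> norm x * K"
    and L: "L > 0" "\<And>x. norm (\<psi> x) \<le> norm x * L"
    using functional_bound[OF fg(1)] functional_bound[OF fg(2)] by metis
  have bound: "norm (\<phi> w) \<le> max K L" "norm (\<psi> w) \<le> max K L" if "w \<in> cball 0 1" for w
  proof -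
    have "norm w * K \<le> 1 * K" "norm w * L \<le> 1 * L"
      using that K(1) L(1) by (intro mult_right_mono; simp)+
    then show "norm (\<phi> w) \<le> max K L" "norm (\<psi> w) \<le> max K L"
      using K(2)[of w] L(2)[of w] by linarith+
  qed
  have "x \<noteq> 0" using fg by (auto simp: functionalD)
  \<comment> \<open>Normalizing \<open>x\<close> gives a point of the ball at which
    \<open>\<phi>\<close> does not vanish, as the rotation lemma requires.\<close>
  then have i0: "sc (of_real (1 / norm x)) x \<in> cball 0 1" "\<phi> (sc (of_real (1 / norm x)) x) \<noteq> 0"
    using fg by (simp_all add: norm_scale norm_divide functionalD)
  obtain a b \<alpha> \<beta> where ab: "a \<noteq> 0 \<or> b \<noteq> 0"
    and le: "\<And>w. w \<in> cball 0 1 \<Longrightarrow>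
      (norm (\<alpha> * \<phi> w + \<beta> * \<psi> w))\<^sup>2 + (norm (a * \<psi> w - b * \<phi> w))\<^sup>2 \<le> 1"
    and sup: "\<And>m. (SUP w\<in>cball 0 1. norm (\<alpha> * \<phi> w + \<beta> * \<psi> w) ^ m) = 1"
    using bound i0 by (rule rotate_to_unit[where I = "cball 0 1" and f = \<phi> and g = \<psi>]) (assumption, assumption, rule that, assumption, blast, blast)
  define p where "p w = \<alpha> * \<phi> w + \<beta> * \<psi> w" for w
  define q where "q w = (- b) * \<phi> w + a * \<psi> w" for w
  have p: "functional p" and q: "functional q"
    unfolding p_def q_def by (rule functional_combination[OF fg(1,2)])+
  have pq_le: "(norm (p w))\<^sup>2 + (norm (q w))\<^sup>2 \<le> 1" if "w \<in> cball 0 1" for w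
    using le[OF that] by (simp add: p_def q_def)
  \<comment> \<open>The supremum formula with exponent 1 shows \<open>p\<close> to be nonzero; with
    exponent \<open>n\<close> it later gives the norm of \<open>P\<close>.\<close>
  have "\<exists>w. p w \<noteq> 0"
  proof (rule ccontr)
    assume "\<nexists>w. p w \<noteq> 0"
    then have "(SUP w\<in>cball 0 1 :: 'a set. norm (p w) ^ 1) = 0" by simp
    then show False using sup[of 1] by (simp add: p_def)
  qed
  \<comment> \<open>By triangularity \<open>q z = a * \<psi> z\<close>; if \<open>a = 0\<close>,
    then \<open>q x = - b * \<phi> x\<close> with \<open>b \<noteq> 0\<close>.\<close>
  moreover have "q x \<noteq> 0 \<or> q z \<noteq> 0"
    using ab fg by (cases "a = 0") (auto simp: q_def)
  ultimately obtain w where w: "p w \<noteq> 0" "q w \<noteq> 0"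
    using common_nonzero_point[OF p q] by metis
  define P where "P w = p w ^ n" for w
  define Q where "Q w = p w ^ (n - 2) * (q w)\<^sup>2" for w
  show ?thesis
    unfolding disc_in_ball_def
  proof (intro bexI conjI allI impI)
    \<comment> \<open>The pure power is the mixed product with \<open>k = 0\<close>.\<close>
    show "P \<in> unit_sphere (poly_space sc n)"
      using homogeneous_poly_prod[OF p p, of 0 n] sup[of n]
      by (simp add: unit_sphere_def poly_space_def P_def[abs_def] norm_power p_def)
    show "Q \<in> pts (poly_space sc n)"
      using homogeneous_poly_prod[OF p q n] by (simp add: poly_space_def Q_def[abs_def])
    have "Q w \<noteq> 0" using w by (simp add: Q_def)
    then show "Q \<noteq> vzero (poly_space sc n)" by (auto simp: poly_space_def)
    show "smul (poly_space sc n) 1 Q = Q" by (simp add: poly_space_def)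
    fix \<zeta> :: 'k assume \<zeta>: "norm \<zeta> = 1"
    have "(SUP w\<in>cball 0 1. norm (P w + \<zeta> * Q w)) \<le> 1"
      unfolding P_def Q_def by (rule cSUP_least) (use norm_disc_le[OF pq_le \<zeta> n] in auto)
    then show "nrm (poly_space sc n) (vadd (poly_space sc n) P (smul (poly_space sc n) \<zeta> Q)) \<le> 1"
      by (simp add: poly_space_def)
  qed
qed

section \<open>Symmetric tensors\<close>

lemma sym_tensors_add_tensor:
  assumes "u \<in> sym_tensors sc n"
  shows "(\<lambda>A. u A + c * tensor sc n (\<lambda>_. x) A) \<in> sym_tensors sc n"
proof -
  obtain k :: nat and lam y where u: "u = (\<lambda>A. \<Sum>j<k. lam j * tensor sc n (\<lambda>_. y j) A)"
    using assms unfolding sym_tensors_def by blast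
  have "(\<Sum>j<Suc k. (lam(k := c)) j * tensor sc n (\<lambda>_. (y(k := x)) j) A) =
      u A + c * tensor sc n (\<lambda>_. x) A" for A
    by (simp add: u)
  then show ?thesis
    unfolding sym_tensors_def by (intro CollectI exI[of _ "Suc k"]) (metis (no_types))
qed

lemma sym_tensors_sum:
  fixes k :: nat
  shows "(\<lambda>A. \<Sum>j<k. lam j * tensor sc n (\<lambda>_. x j) A) \<in> sym_tensors sc n"
  unfolding sym_tensors_def by blast

lemma sym_tensors_add:
  assumes u: "u \<in> sym_tensors sc n" and v: "v \<in> sym_tensors sc n"
  shows "(\<lambda>A. u A + v A) \<in> sym_tensors sc n"
proof -
  obtain k :: nat and lam y where v: "v = (\<lambda>A. \<Sum>j<k. lam j * tensor sc n (\<lambda>_. y j) A)"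
    using v unfolding sym_tensors_def by blast
  have "(\<lambda>A. u A + (\<Sum>j<k. lam j * tensor sc n (\<lambda>_. y j) A)) \<in> sym_tensors sc n"
  proof (induction k)
    case (Suc k)
    then show ?case
      using sym_tensors_add_tensor[OF Suc, of "lam k" "y k"] by (simp add: add.assoc)
  qed (use u in simp)
  then show ?thesis by (simp add: v)
qed

lemma sym_tensors_scale:
  assumes "u \<in> sym_tensors sc n"
  shows "(\<lambda>A. c * u A) \<in> sym_tensors sc n"
proof -
  obtain k :: nat and lam y where u: "u = (\<lambda>A. \<Sum>j<k. lam j * tensor sc n (\<lambda>_. y j) A)"
    using assms unfolding sym_tensors_def by blast
  show ?thesis
    using sym_tensors_sum[where lam = "\<lambda>j. c * lam j" and k = k and x = y]
    by (simp add: u sum_distrib_left mult.assoc)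
qed

section \<open>The injective norm\<close>

definition pow_form :: "nat \<Rightarrow> ('a \<Rightarrow> 'k) \<Rightarrow> (nat \<Rightarrow> 'a) \<Rightarrow> 'k" where
  "pow_form n \<phi> = (\<lambda>x. \<Prod>i<n. \<phi> (x i))"

lemma inj_norm_pow_form: "inj_norm sc n u = (SUP \<phi>\<in>dual_ball sc. norm (u (pow_form n \<phi>)))"
  by (simp add: inj_norm_def pow_form_def)

lemma tensor_pow_form:
  assumes "functional \<phi>"
  shows "tensor sc n (\<lambda>_. x) (pow_form n \<phi>) = \<phi> x ^ n"
  using assms multilinear_form_prod[of sc \<phi> n]
  by (simp add: tensor_def pow_form_def functional_def)

text \<open>The triangle inequality in any representation of \<open>u\<close> gives a bound. Without
  boundedness the real \<open>SUP\<close> would not be known to be an upper bound.\<close>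

lemma inj_norm_bdd:
  assumes "u \<in> sym_tensors sc n"
  shows "bdd_above ((\<lambda>\<phi>. norm (u (pow_form n \<phi>))) ` dual_ball sc)"
proof -
  obtain k :: nat and lam y where u: "u = (\<lambda>A. \<Sum>j<k. lam j * tensor sc n (\<lambda>_. y j) A)"
    using assms unfolding sym_tensors_def by blast
  show ?thesis
  proof (rule bdd_aboveI2)
    fix \<phi> assume \<phi>: "\<phi> \<in> dual_ball sc"
    have "norm (u (pow_form n \<phi>)) = norm (\<Sum>j<k. lam j * \<phi> (y j) ^ n)"
      by (simp add: u tensor_pow_form[OF dual_ballD(1)[OF \<phi>]])
    also have "\<dots> \<le> (\<Sum>j<k. norm (lam j) * norm (y j) ^ n)"
      by (intro sum_norm_le)
        (simp add: norm_mult norm_power mult_left_mono power_mono dual_ballD(2)[OF \<phi>])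
    finally show "norm (u (pow_form n \<phi>)) \<le> (\<Sum>j<k. norm (lam j) * norm (y j) ^ n)" .
  qed
qed

lemma norm_le_inj_norm:
  "u \<in> sym_tensors sc n \<Longrightarrow> \<phi> \<in> dual_ball sc \<Longrightarrow> norm (u (pow_form n \<phi>)) \<le> inj_norm sc n u"
  unfolding inj_norm_pow_form by (rule cSUP_upper[OF _ inj_norm_bdd])

lemma inj_norm_le:
  "(\<And>\<phi>. \<phi> \<in> dual_ball sc \<Longrightarrow> norm (u (pow_form n \<phi>)) \<le> c) \<Longrightarrow> inj_norm sc n u \<le> c"
  unfolding inj_norm_pow_form by (rule cSUP_least) (use zero_in_dual_ball in auto)

lemma inj_norm_scale_le:
  "u \<in> sym_tensors sc n \<Longrightarrow> inj_norm sc n (\<lambda>A. c * u A) \<le> norm c * inj_norm sc n u"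
  by (rule inj_norm_le) (simp add: norm_mult mult_left_mono norm_le_inj_norm)

text \<open>For \<open>c \<noteq> 0\<close> the reverse inequality is the easy one applied to
  \<open>inverse c\<close> and the scaled tensor.\<close>

lemma inj_norm_scale:
  assumes u: "u \<in> sym_tensors sc n"
  shows "inj_norm sc n (\<lambda>A. c * u A) = norm c * inj_norm sc n u"
proof (cases "c = 0")
  case True
  have "dual_ball sc \<noteq> {}" using zero_in_dual_ball by auto
  then show ?thesis using True by (simp add: inj_norm_pow_form)
next
  case False
  have "inj_norm sc n u \<le> norm (inverse c) * inj_norm sc n (\<lambda>A. c * u A)"
    using inj_norm_scale_le[OF sym_tensors_scale[OF u, of c], of "inverse c"] False
    by (simp add: mult.assoc[symmetric])
  then have "norm c * inj_norm sc n u \<le> inj_norm sc n (\<lambda>A. c * u A)"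
    using False by (simp add: norm_divide field_simps)
  then show ?thesis using inj_norm_scale_le[OF u, of c] by simp
qed

lemma seminormed_sym_tensors:
  "seminormed_functions (sym_tensors sc n) (inj_norm sc n) (sym_tensor_space sc n)"
proof
  show "(\<lambda>A. 0) \<in> sym_tensors sc n" using sym_tensors_sum[where k = 0] by simp
  fix u v assume uv: "u \<in> sym_tensors sc n" "v \<in> sym_tensors sc n"
  show "inj_norm sc n (\<lambda>A. u A + v A) \<le> inj_norm sc n u + inj_norm sc n v"
    by (rule inj_norm_le)
      (intro order_trans[OF norm_triangle_ineq] add_mono norm_le_inj_norm uv)
qed (auto simp: sym_tensor_space_def sym_tensors_add sym_tensors_scale inj_norm_scale)

text \<open>
  The symmetrization of \<open>x\<^sup>n\<^sup>-\<^sup>m \<otimes> y\<^sup>m\<close>, written as a combination of the powers of \<open>x + j y\<close>.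
\<close>

lemma mixed_power_tensor:
  assumes "m \<le> n"
  obtains v where "v \<in> sym_tensors sc n"
    "\<And>\<phi>. functional \<phi> \<Longrightarrow> v (pow_form n \<phi>) = \<phi> x ^ (n - m) * \<phi> y ^ m"
proof -
  obtain w :: "nat \<Rightarrow> 'k" where w: "\<And>i. i \<le> n \<Longrightarrow>
      (\<Sum>j\<le>n. w j * of_nat j ^ i) = (if i = m then 1 else 0)"
    using interpolation_weights by blast
  define C :: 'k where "C = of_nat (n choose m)"
  have "C \<noteq> 0" using assms by (simp add: C_def)
  \<comment> \<open>The division by \<open>C\<close> cancels the binomial coefficient: the
    coefficient of \<open>t ^ m\<close> in \<open>(\<phi> x + t * \<phi> y) ^ n\<close> is
    \<open>C * \<phi> x ^ (n - m) * \<phi> y ^ m\<close>. The bound \<open>Suc n\<close> makes the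
    nodes run through \<open>0, ..., n\<close>.\<close>
  define v where "v = (\<lambda>A. \<Sum>j<Suc n. (w j / C) * tensor sc n (\<lambda>_. x + sc (of_nat j) y) A)"
  have "v (pow_form n \<phi>) = \<phi> x ^ (n - m) * \<phi> y ^ m" if \<phi>: "functional \<phi>" for \<phi>
  proof -
    have "v (pow_form n \<phi>) = (\<Sum>j\<le>n. (w j / C) * (of_nat j * \<phi> y + \<phi> x) ^ n)"
      by (simp add: v_def tensor_pow_form[OF \<phi>] functionalD[OF \<phi>] lessThan_Suc_atMost add.commute
          del: sum.lessThan_Suc)
    also have "\<dots> = (\<Sum>j\<le>n. \<Sum>i\<le>n. of_nat (n choose i) / C * \<phi> y ^ i * \<phi> x ^ (n - i) *
        (w j * of_nat j ^ i))"
      unfolding binomial_ring sum_distrib_left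
      by (intro sum.cong refl) (simp add: power_mult_distrib field_simps)
    \<comment> \<open>With the sums exchanged, the inner one is the interpolation identity and
      leaves only \<open>i = m\<close>.\<close>
    also have "\<dots> = (\<Sum>i\<le>n. of_nat (n choose i) / C * \<phi> y ^ i * \<phi> x ^ (n - i) *
        (\<Sum>j\<le>n. w j * of_nat j ^ i))"
      unfolding sum_distrib_left by (rule sum.swap)
    also have "\<dots> = (\<Sum>i\<le>n. if i = m then of_nat (n choose i) / C * \<phi> y ^ i * \<phi> x ^ (n - i) else 0)"
      by (rule sum.cong) (auto simp: w)
    also have "\<dots> = \<phi> x ^ (n - m) * \<phi> y ^ m"
      using assms \<open>C \<noteq> 0\<close> by (subst sum.delta) (auto simp: C_def[symmetric] mult.commute)
    finally show ?thesis .
  qed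
  moreover have "v \<in> sym_tensors sc n" unfolding v_def by (rule sym_tensors_sum)
  ultimately show ?thesis using that by blast
qed

lemma disc_in_sym_inj_tensor_product:
  assumes ind: "\<And>a b. sc a x + sc b y = 0 \<Longrightarrow> a = 0 \<and> b = 0" and n: "n \<ge> 2"
  shows "disc_in_ball (sym_inj_tensor_product sc n)"
proof -
  have "x \<noteq> 0" using ind[of 1 0] by auto
  then obtain \<phi>0 where \<phi>0: "\<phi>0 \<in> dual_ball sc" "\<phi>0 x \<noteq> 0"
    using common_nonzero_functional by blast
  have bound: "norm (\<phi> x) \<le> max (norm x) (norm y)" "norm (\<phi> y) \<le> max (norm x) (norm y)"
    if "\<phi> \<in> dual_ball sc" for \<phi>
    using dual_ballD(2)[OF that, of x] dual_ballD(2)[OF that, of y] by auto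
  obtain a b \<alpha> \<beta> where ab: "a \<noteq> 0 \<or> b \<noteq> 0"
    and le: "\<And>\<phi>. \<phi> \<in> dual_ball sc \<Longrightarrow>
      (norm (\<alpha> * \<phi> x + \<beta> * \<phi> y))\<^sup>2 + (norm (a * \<phi> y - b * \<phi> x))\<^sup>2 \<le> 1"
    and sup: "\<And>m. (SUP \<phi>\<in>dual_ball sc. norm (\<alpha> * \<phi> x + \<beta> * \<phi> y) ^ m) = 1"
    using bound \<phi>0
    by (rule rotate_to_unit[where I = "dual_ball sc" and f = "\<lambda>\<phi>. \<phi> x" and g = "\<lambda>\<phi>. \<phi> y"
        and K = "max (norm x) (norm y)" and ?i0.0 = \<phi>0])
      (assumption, assumption, rule that, assumption, blast, blast)
  \<comment> \<open>The rotated evaluations on the dual ball are themselves evaluations, at the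
    vectors \<open>p\<close> and \<open>q\<close>.\<close>
  define p where "p = sc \<alpha> x + sc \<beta> y"
  define q where "q = sc (- b) x + sc a y"
  have eval: "\<phi> p = \<alpha> * \<phi> x + \<beta> * \<phi> y" "\<phi> q = a * \<phi> y - b * \<phi> x"
    if "\<phi> \<in> dual_ball sc" for \<phi>
  proof -
    have "\<phi> p = \<alpha> * \<phi> x + \<beta> * \<phi> y" "\<phi> q = (- b) * \<phi> x + a * \<phi> y"
      unfolding p_def q_def by (simp_all only: functionalD[OF dual_ballD(1)[OF that]])
    then show "\<phi> p = \<alpha> * \<phi> x + \<beta> * \<phi> y" "\<phi> q = a * \<phi> y - b * \<phi> x" by simp_all
  qed
  have "q \<noteq> 0" using ind[of "- b" a] ab by (auto simp: q_def)
  have sup_p: "(SUP \<phi>\<in>dual_ball sc. norm (\<phi> p) ^ m) = 1" for m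
    using sup[of m] by (simp add: eval cong: SUP_cong_simp)
  have "p \<noteq> 0"
  proof
    assume "p = 0"
    then have "(SUP \<phi>\<in>dual_ball sc. norm (\<phi> p) ^ 1) = (SUP \<phi>\<in>dual_ball sc. 0)"
      by (intro SUP_cong) (auto simp: functionalD[OF dual_ballD(1)])
    moreover have "dual_ball sc \<noteq> {}" using \<phi>0 by auto
    ultimately show False using sup_p[of 1] by simp
  qed
  \<comment> \<open>A functional that vanishes at neither vector will detect the tensor
    \<open>v\<close> and give it positive injective norm.\<close>
  then obtain \<phi>1 where \<phi>1: "\<phi>1 \<in> dual_ball sc" "\<phi>1 p \<noteq> 0" "\<phi>1 q \<noteq> 0"
    using common_nonzero_functional \<open>q \<noteq> 0\<close> by blast
  \<comment> \<open>With \<open>m = 0\<close> and both vectors equal to \<open>p\<close>, the mixed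
    tensor acts as the pure power of \<open>p\<close>.\<close>
  obtain u where u: "u \<in> sym_tensors sc n"
    "\<And>\<phi>. functional \<phi> \<Longrightarrow> u (pow_form n \<phi>) = \<phi> p ^ (n - 0) * \<phi> p ^ 0"
    using mixed_power_tensor[of 0 n p p] by auto
  obtain v where v: "v \<in> sym_tensors sc n"
    "\<And>\<phi>. functional \<phi> \<Longrightarrow> v (pow_form n \<phi>) = \<phi> p ^ (n - 2) * (\<phi> q)\<^sup>2"
    using mixed_power_tensor[OF n, of p q] by auto
  interpret seminormed_functions "sym_tensors sc n" "inj_norm sc n" "sym_tensor_space sc n"
    by (rule seminormed_sym_tensors)
  show ?thesis
    unfolding sym_inj_tensor_product_def
  proof (rule disc_in_completion)
    show "u \<in> sym_tensors sc n" "v \<in> sym_tensors sc n" by fact+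
    have "inj_norm sc n u = (SUP \<phi>\<in>dual_ball sc. norm (\<phi> p) ^ n)"
      unfolding inj_norm_pow_form
      by (rule SUP_cong) (auto simp: u(2)[OF dual_ballD(1)] norm_power)
    then show "inj_norm sc n u = 1" by (simp add: sup_p)
    have "0 < norm (v (pow_form n \<phi>1))"
      using \<phi>1 by (simp add: v(2)[OF dual_ballD(1)])
    then show "inj_norm sc n v \<noteq> 0" using norm_le_inj_norm[OF v(1) \<phi>1(1)] by linarith
    fix \<zeta> :: 'k assume \<zeta>: "norm \<zeta> = 1"
    show "inj_norm sc n (\<lambda>A. u A + \<zeta> * v A) \<le> 1"
    proof (rule inj_norm_le)
      fix \<phi> assume \<phi>: "\<phi> \<in> dual_ball sc"
      have "(norm (\<phi> p))\<^sup>2 + (norm (\<phi> q))\<^sup>2 \<le> 1" using le[OF \<phi>] by (simp add: eval[OF \<phi>])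
      then show "norm (u (pow_form n \<phi>) + \<zeta> * v (pow_form n \<phi>)) \<le> 1"
        using norm_disc_le[OF _ \<zeta> n] by (simp add: u(2) v(2) dual_ballD(1)[OF \<phi>])
    qed
  qed
qed

end

section \<open>Real and complex scalars\<close>

lemma separated_space_real: "separated_space (scaleR :: real \<Rightarrow> 'a::banach \<Rightarrow> 'a) id"
proof -
  interpret banach_over "scaleR :: real \<Rightarrow> 'a \<Rightarrow> 'a" by (rule banach_over_scaleR)
  show ?thesis
  proof
    show "(norm (id a * s + id b * t))\<^sup>2 + (norm (a * t - b * s))\<^sup>2 =
        ((norm a)\<^sup>2 + (norm b)\<^sup>2) * ((norm s)\<^sup>2 + (norm t)\<^sup>2)" for a b s t :: real
      by (simp add: power2_eq_square algebra_simps)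
    fix x :: 'a assume "x \<noteq> 0"
    then obtain f :: "'a \<Rightarrow> real" where f: "bounded_linear f" "f x \<noteq> 0"
      using bounded_linear_separating by blast
    interpret f: bounded_linear f by fact
    obtain K where "\<And>z. norm (f z) \<le> norm z * K" using f.bounded by blast
    then have "functional f" by (intro functionalI) (auto simp: f.add f.scaleR)
    then show "\<exists>\<phi>. functional \<phi> \<and> \<phi> x \<noteq> 0" using f(2) by blast
  qed
qed

text \<open>A separating real functional \<open>f\<close> is complexified:
  \<open>f z - \<i> * f (\<i> z)\<close> is complex linear and has real part \<open>f\<close>, so it
  still does not vanish at \<open>x\<close>.\<close>

lemma separated_space_complex:
  fixes sc :: "complex \<Rightarrow> 'a::banach \<Rightarrow> 'a"
  assumes "banach_over sc"
  shows "separated_space sc cnj"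
proof -
  interpret banach_over sc by fact
  show ?thesis
  proof
    show "(norm (cnj a * s + cnj b * t))\<^sup>2 + (norm (a * t - b * s))\<^sup>2 =
        ((norm a)\<^sup>2 + (norm b)\<^sup>2) * ((norm s)\<^sup>2 + (norm t)\<^sup>2)" for a b s t :: complex
      by (simp add: cmod_power2) (simp add: power2_eq_square algebra_simps)
    fix x :: 'a assume "x \<noteq> 0"
    then obtain f :: "'a \<Rightarrow> real" where f: "bounded_linear f" "f x \<noteq> 0"
      using bounded_linear_separating by blast
    interpret f: bounded_linear f by fact
    obtain K where K: "\<And>z. norm (f z) \<le> norm z * K" using f.bounded by blast
    define \<phi> where "\<phi> z = Complex (f z) (- f (sc \<i> z))" for z
    have sc: "sc c z = Re c *\<^sub>R z + Im c *\<^sub>R sc \<i> z" for c z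
    proof -
      \<comment> \<open>Complex scaling is reduced to real scaling and multiplication by
        \<open>\<i>\<close>, where the real linearity of \<open>f\<close> applies.\<close>
      have "sc c z = sc (of_real (Re c) + of_real (Im c) * \<i>) z"
        by (simp add: complex_eq mult.commute)
      then show ?thesis
        by (simp only: scale_left_distrib scale_scale[symmetric] scale_of_real)
    qed
    have i_sc: "sc \<i> (sc c z) = Re c *\<^sub>R sc \<i> z - Im c *\<^sub>R z" for c z
      using sc[of "\<i> * c" z] by simp
    have "functional \<phi>"
    proof (rule functionalI)
      show "\<phi> (z + w) = \<phi> z + \<phi> w" for z w
        by (simp add: \<phi>_def f.add scale_right_distrib complex_eq_iff)
      show "\<phi> (sc c z) = c * \<phi> z" for c z
        unfolding \<phi>_def i_sc
        by (subst sc) (simp add: f.add f.diff f.scaleR complex_eq_iff algebra_simps)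
      show "norm (\<phi> z) \<le> norm z * (2 * K)" for z
        using cmod_le[of "\<phi> z"] K[of z] K[of "sc \<i> z"]
        by (simp add: \<phi>_def norm_scale)
    qed
    moreover have "\<phi> x \<noteq> 0" using f(2) by (simp add: \<phi>_def complex_eq_iff)
    ultimately show "\<exists>\<phi>. functional \<phi> \<and> \<phi> x \<noteq> 0" by blast
  qed
qed

theorem theorem1p2:
  fixes n :: nat
    and cscale :: "complex \<Rightarrow> 'b::banach \<Rightarrow> 'b"
  assumes "n \<ge> 2"
  shows
    "((\<exists>B :: 'a::banach set. card B = 2 \<and> \<not> module.dependent (scaleR :: real \<Rightarrow> 'a \<Rightarrow> 'a) B) \<longrightarrow>
        \<not> strictly_convex (sym_inj_tensor_product (scaleR :: real \<Rightarrow> 'a \<Rightarrow> 'a) n) \<and>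
        \<not> strictly_convex (poly_space (scaleR :: real \<Rightarrow> 'a \<Rightarrow> 'a) n)) \<and>
     (banach_over cscale \<and> (\<exists>B. card B = 2 \<and> \<not> module.dependent cscale B) \<longrightarrow>
        \<not> complex_strictly_convex (sym_inj_tensor_product cscale n) \<and>
        \<not> complex_strictly_convex (poly_space cscale n))"
proof (rule conjI; rule impI)
  assume B: "\<exists>B :: 'a set. card B = 2 \<and> \<not> module.dependent (scaleR :: real \<Rightarrow> 'a \<Rightarrow> 'a) B"
  interpret separated_space "scaleR :: real \<Rightarrow> 'a \<Rightarrow> 'a" id by (rule separated_space_real)
  obtain x y :: 'a where xy: "\<And>a b. a *\<^sub>R x + b *\<^sub>R y = 0 \<Longrightarrow> a = 0 \<and> b = 0"
    using independent_pair B by blast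
  show "\<not> strictly_convex (sym_inj_tensor_product (scaleR :: real \<Rightarrow> 'a \<Rightarrow> 'a) n) \<and>
      \<not> strictly_convex (poly_space (scaleR :: real \<Rightarrow> 'a \<Rightarrow> 'a) n)"
    using disc_in_sym_inj_tensor_product[OF xy assms] disc_in_poly_space[OF xy assms]
    by (blast dest: not_strictly_convex_if_disc)
next
  assume B: "banach_over cscale \<and> (\<exists>B. card B = 2 \<and> \<not> module.dependent cscale B)"
  then interpret separated_space cscale cnj by (intro separated_space_complex) blast
  obtain x y where xy: "\<And>a b. cscale a x + cscale b y = 0 \<Longrightarrow> a = 0 \<and> b = 0"
    using independent_pair B by blast
  show "\<not> complex_strictly_convex (sym_inj_tensor_product cscale n) \<and>
      \<not> complex_strictly_convex (poly_space cscale n)"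
    using disc_in_sym_inj_tensor_product[OF xy assms] disc_in_poly_space[OF xy assms]
    by (blast dest: not_complex_strictly_convex_if_disc)
qed

end
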